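(* Let $\mathbb{L}$ be an $F$-finite field of prime characteristic $p>0$, let $R=\mathbb{L}[x_1,\dots,x_n]$ with $n\ge 1$, let $\mathfrak{m}=(x_1,\dots,x_n)$, and let $S=R_{\mathfrak{m}}$. Let $f\in R$ be such that $\sqrt{\operatorname{Jac}(f)}=\mathfrak{m}$. Set $\ell=\operatorname{length}_R\bigl(R/\operatorname{Jac}(f)\bigr)$ and $N=p^{2\ell}\cdot\dim(R)$ (so $\dim(R)=n$). Then \[\operatorname{fpt}(S,f)=\operatorname{fpt}(S,f+h)\quad\text{for every } h\in\mathfrak{m}^{N}.\]
   Context: A field $\mathbb{L}$ of characteristic $p>0$ is $F$-finite if $[\mathbb{L}:\mathbb{L}^p]<\infty$. For $f\in R=\mathbb{L}[x_1,\dots,x_n]$, $\operatorname{Jac}(f)$ denotes the ideal of $R$ generated by $f$ and all of its partial derivatives $\partial f/\partial x_i$. Let $A$ be an $F$-finite regular ring of characteristic $p$ (here $A=S$) and $g\in A$. For an ideal $\mathfrak{b}$ and $e\ge 0$, $\mathfrak{b}^{[p^e]}$ is the ideal generated by the $p^e$-th powers of elements of $\mathfrak{b}$. For $g\in A$ and $e\ge 1$, $(g)^{[1/p^e]}$ is the smallest ideal $\mathfrak{b}$ of $A$ with $g\in\mathfrak{b}^{[p^e]}$ (it exists because $A$ is regular and $F$-finite). For a real $\lambda\ge 0$, the test ideal is $\tau(A,g^{\lambda})=\bigcup_{e\ge1}\bigl(g^{\lceil p^e\lambda\rceil}\bigr)^{[1/p^e]}$ (an ascending union, which stabilizes). The $F$-pure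 threshold is $\operatorname{fpt}(A,g)=\sup\{\lambda>0:\tau(A,g^{\lambda})=A\}$. Elements of $R$ are regarded as elements of $S$ via localization. *)

theory Defs
  imports
    "HOL-Library.Cardinality"
    "HOL-Library.Poly_Mapping"
    "HOL-Library.Extended_Nat"
    "HOL-Library.Extended_Nonnegative_Real"
    "HOL-Computational_Algebra.Computational_Algebra"
    "HOL-Algebra.Algebra"
begin

section \<open>Rings carried by types of class \<open>comm_ring_1\<close>\<close>

definition ring_on :: "'a::comm_ring_1 set \<Rightarrow> 'a ring" where
  "ring_on A = \<lparr>carrier = A, mult = (*), one = 1, ring.zero = 0, add = (+)\<rparr>"

text \<open>
  For a prime ideal \<open>P\<close> of a domain, the localization at \<open>P\<close> is realised as the subring of the
  fraction field consisting of the fractions \<open>a / b\<close> with \<open>b \<notin> P\<close>.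
\<close>

definition localization :: "'a::idom set \<Rightarrow> 'a fract ring" where
  "localization P = ring_on {Fraction_Field.Fract a b | a b. b \<notin> P}"

definition to_localization :: "'a::idom \<Rightarrow> 'a fract" where
  "to_localization a = Fraction_Field.Fract a 1"


section \<open>Polynomial rings\<close>

text \<open>
  Polynomials over \<open>'k\<close> in the variables indexed by the finite type \<open>'n\<close>, i.e. in \<open>CARD('n) \<ge> 1\<close>
  variables: finitely supported maps from exponent vectors to coefficients, with the convolution
  product.  A linear order on \<open>'n\<close> is what the library needs to make this type an integral domain;
  it plays no other role.
\<close>

type_synonym ('n, 'k) mpoly = "('n \<Rightarrow>\<^sub>0 nat) \<Rightarrow>\<^sub>0 'k"

definition mpoly_var :: "'n \<Rightarrow> ('n, 'k::comm_ring_1) mpoly" where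
  "mpoly_var i = Poly_Mapping.single (Poly_Mapping.single i 1) 1"

text \<open>In a monomial with exponent \<open>0\<close> at \<open>i\<close> the subtraction truncates, but the coefficient is \<open>0\<close>.\<close>

definition partial_deriv :: "'n \<Rightarrow> ('n, 'k::comm_ring_1) mpoly \<Rightarrow> ('n, 'k) mpoly" where
  "partial_deriv i f =
     (\<Sum>m\<in>Poly_Mapping.keys f.
        Poly_Mapping.single (m - Poly_Mapping.single i 1)
          (of_nat (Poly_Mapping.lookup m i) * Poly_Mapping.lookup f m))"

definition mpoly_ring :: "('n, 'k::comm_ring_1) mpoly ring" where
  "mpoly_ring = ring_on UNIV"

definition irrelevant_ideal :: "('n, 'k::comm_ring_1) mpoly set" where
  "irrelevant_ideal = Idl\<^bsub>mpoly_ring\<^esub> (range mpoly_var)"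

definition Jac :: "('n, 'k::comm_ring_1) mpoly \<Rightarrow> ('n, 'k) mpoly set" where
  "Jac f = Idl\<^bsub>mpoly_ring\<^esub> (insert f (range (\<lambda>i. partial_deriv i f)))"


section \<open>Radicals, quotient modules and length\<close>

definition ideal_radical :: "('a, 'b) ring_scheme \<Rightarrow> 'a set \<Rightarrow> 'a set" where
  "ideal_radical R I = {x \<in> carrier R. \<exists>k::nat. k > 0 \<and> x [^]\<^bsub>R\<^esub> k \<in> I}"

definition quotient_module :: "('a, 'b) ring_scheme \<Rightarrow> 'a set \<Rightarrow> ('a, 'a set) module" where
  "quotient_module R I =
     \<lparr>carrier = carrier (R Quot I), mult = mult (R Quot I), one = one (R Quot I),
      ring.zero = \<zero>\<^bsub>R Quot I\<^esub>, add = add (R Quot I),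
      smult = (\<lambda>r C. (I +>\<^bsub>R\<^esub> r) \<otimes>\<^bsub>R Quot I\<^esub> C)\<rparr>"

text \<open>The length of a module: the supremum of the lengths of its strict chains of submodules.\<close>

definition module_length :: "('a, 'b) ring_scheme \<Rightarrow> ('a, 'c, 'd) module_scheme \<Rightarrow> enat" where
  "module_length R M =
     Sup {enat k | k. \<exists>N. (\<forall>i\<le>k. submodule (N i) R M) \<and> (\<forall>i<k. N i \<subset> N (Suc i))}"


section \<open>Test ideals and \<open>F\<close>-pure thresholds\<close>

text \<open>\<open>[K : K\<^sup>p] < \<infinity>\<close>\<close>

definition F_finite_field :: "('a, 'b) ring_scheme \<Rightarrow> nat \<Rightarrow> bool" where
  "F_finite_field K p \<longleftrightarrow>
     ring.finite_dimension K {x [^]\<^bsub>K\<^esub> p | x. x \<in> carrier K} (carrier K)"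

definition frob_power :: "('a, 'b) ring_scheme \<Rightarrow> nat \<Rightarrow> nat \<Rightarrow> 'a set \<Rightarrow> 'a set" where
  "frob_power A p e I = Idl\<^bsub>A\<^esub> {x [^]\<^bsub>A\<^esub> (p ^ e) | x. x \<in> I}"

text \<open>The ideal \<open>(g)\<^bsup>[1/p^e]\<^esup>\<close>; \<open>LEAST\<close> is with respect to inclusion of sets.\<close>

definition frob_root :: "('a, 'b) ring_scheme \<Rightarrow> nat \<Rightarrow> nat \<Rightarrow> 'a \<Rightarrow> 'a set" where
  "frob_root A p e g = (LEAST I. ideal I A \<and> g \<in> frob_power A p e I)"

definition test_ideal :: "('a, 'b) ring_scheme \<Rightarrow> nat \<Rightarrow> 'a \<Rightarrow> real \<Rightarrow> 'a set" where
  "test_ideal A p g t = (\<Union>e\<in>{1..}. frob_root A p e (g [^]\<^bsub>A\<^esub> nat \<lceil>real p ^ e * t\<rceil>))"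

text \<open>
  The supremum is taken in \<open>[0, \<infinity>]\<close>, so that it is \<open>0\<close> for \<open>g = 0\<close> and \<open>\<infinity>\<close> for units \<open>g\<close>.
\<close>

definition fpt :: "('a, 'b) ring_scheme \<Rightarrow> nat \<Rightarrow> 'a \<Rightarrow> ennreal" where
  "fpt A p g = Sup {ennreal t | t. t > 0 \<and> test_ideal A p g t = carrier A}"

end

(*
  Let m be the homogeneous maximal ideal and J = Jac f.  Cartier (p^{-1}-linear) maps detect
  membership in Frobenius powers I^[p], so Frobenius powers commute with colons and
  intersections; hence fpt is determined by the exponents a < p^e with f^a in m^[p^e].

  If f^(p-1) J lies in K^[p], then J lies in K: the Cartier map that projects to the exponents
  congruent to (p-1) e_i kills every derivative with respect to x_i and sends f^(p-1) d_i f, which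
  is d_i (f^p / p) formally, to d_i f.  Filtering R/J by order gives (polynomials of order >= l) <= J,
  so h lies in (order >= l+1)^[p]; by Nakayama the same descent then holds for f + h, for m-primary K.
  Comparing f^a and (f+h)^a in K^[p^e] by induction on e: if J is not contained in K, neither belongs
  to it by the descent, and if J is contained in K then h is in K^[p], so f and f+h give the same colon
  ideals (K^[p] : f^d).
*)

theory Submission
  imports Defs
begin

section \<open>Frobenius powers of ideals\<close>

text \<open>The descent for \<open>f + h\<close> must again conclude with \<open>Jac f\<close>, not
  with the Jacobian ideal of \<open>f + h\<close>: the induction on e splits on whether J lies in K,
  and one J has to serve both polynomials. Nor can the induction stay with K = m: it passes to colon
  ideals (K^[p] : f^d), which contain K^[p] and may be the whole ring. The condition on K therefore
  has to survive Frobenius powers and enlargement, and still allow a Nakayama argument in a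
  polynomial ring, which is not local. Containing some power of m meets all three demands. The
  constant p^(2l) n comes from a degree count: a polynomial of order at least N lies in (order >=
  l+1)^[p] as soon as N + p > p (l+1) + n (p-1). Asking for order l+1, one more than the l with
  (order >= l) <= J, creates the gap that Nakayama closes. The colon and intersection formulas are
  proved for polynomials; ideals of the local ring are reached through their contractions.\<close>

interpretation ring_ideal: Modules.module "(*) :: 'a \<Rightarrow> 'a \<Rightarrow> 'a::comm_ring_1"
  by standard (auto simp: algebra_simps)

text \<open>This instance reverses \<open>mult.assoc\<close>, with which it would loop.\<close>

declare ring_ideal.scale_scale [simp del]

text \<open>The single exponent p is primitive and I^[p^e] is the e-fold iterate, so that an
  induction on e peels off one Frobenius power at a time.\<close>

definition frobenius_ideal :: "nat \<Rightarrow> 'a::comm_ring_1 set \<Rightarrow> 'a set" where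
  "frobenius_ideal p I = ring_ideal.span ((\<lambda>x. x ^ p) ` I)"

definition colon_ideal :: "'a::comm_ring_1 set \<Rightarrow> 'a \<Rightarrow> 'a set" where
  "colon_ideal I r = {x. r * x \<in> I}"

lemma mem_colon_ideal: "x \<in> colon_ideal I r \<longleftrightarrow> r * x \<in> I"
  by (simp add: colon_ideal_def)

lemma subspace_colon_ideal:
  assumes "ring_ideal.subspace I"
  shows "ring_ideal.subspace (colon_ideal I r)"
proof (rule ring_ideal.subspaceI)
  fix c x assume "x \<in> colon_ideal I r"
  then have "c * (r * x) \<in> I"
    using ring_ideal.subspace_scale[OF assms] by (simp add: mem_colon_ideal)
  then show "c * x \<in> colon_ideal I r"
    by (simp add: mem_colon_ideal mult.left_commute)
qed (use assms in \<open>auto simp: mem_colon_ideal distrib_left ring_ideal.subspace_0 ring_ideal.subspace_add\<close>)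

lemma subset_colon_ideal:
  assumes "ring_ideal.subspace I"
  shows "I \<subseteq> colon_ideal I r"
  using ring_ideal.subspace_scale[OF assms] by (auto simp: mem_colon_ideal)

lemma ideal_mult_right:
  assumes "ring_ideal.subspace I" "x \<in> I"
  shows "x * r \<in> I"
  using ring_ideal.subspace_scale[OF assms, of r] by (simp add: mult.commute)

lemma ideal_add_cancel:
  assumes "ring_ideal.subspace I" "x - y \<in> I"
  shows "x \<in> I \<longleftrightarrow> y \<in> I"
proof
  assume "x \<in> I"
  then show "y \<in> I" using ring_ideal.subspace_diff[OF assms(1) \<open>x \<in> I\<close> assms(2)] by simp
next
  assume "y \<in> I"
  then show "x \<in> I" using ring_ideal.subspace_add[OF assms(1) assms(2)] by force
qed

lemma ideal_power_diff:
  fixes x y :: "'a::comm_ring_1"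
  assumes "ring_ideal.subspace I" "x - y \<in> I"
  shows "x ^ n - y ^ n \<in> I"
  using assms by (simp add: power_diff_sumr2 ideal_mult_right)

lemma subspace_frobenius_ideal [simp]: "ring_ideal.subspace (frobenius_ideal p I)"
  by (simp add: frobenius_ideal_def)

lemma power_mem_frobenius_ideal: "x \<in> I \<Longrightarrow> x ^ p \<in> frobenius_ideal p I"
  by (auto simp: frobenius_ideal_def intro: ring_ideal.span_base)

lemma frobenius_ideal_mono: "I \<subseteq> I' \<Longrightarrow> frobenius_ideal p I \<subseteq> frobenius_ideal p I'"
  unfolding frobenius_ideal_def by (intro ring_ideal.span_mono image_mono)

lemma subspace_frobenius_iter:
  "ring_ideal.subspace I \<Longrightarrow> ring_ideal.subspace ((frobenius_ideal p ^^ e) I)"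
  by (induction e) auto

lemma frobenius_iter_mono:
  "I \<subseteq> I' \<Longrightarrow> (frobenius_ideal p ^^ e) I \<subseteq> (frobenius_ideal p ^^ e) I'"
  by (induction e) (auto dest: frobenius_ideal_mono)

lemma power_mem_frobenius_iter: "x \<in> I \<Longrightarrow> x ^ (p ^ e) \<in> (frobenius_ideal p ^^ e) I"
proof (induction e)
  case (Suc e)
  from power_mem_frobenius_ideal[OF Suc.IH[OF Suc.prems], of p] show ?case
    by (simp add: mult.commute flip: power_mult)
qed simp

text \<open>By the freshman's dream, the p-th power of a combination of elements z^(p^e) is a
  combination of elements z^(p^(e+1)). Hence the iterate is the usual I^[p^e]; this generator form
  is the one that can be compared with \<open>frob_power\<close>.\<close>

lemma frobenius_iter_eq_span:
  fixes I :: "'a::comm_ring_1 set"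
  assumes "Factorial_Ring.prime p" "CHAR('a) = p" "ring_ideal.subspace I"
  shows "(frobenius_ideal p ^^ e) I = ring_ideal.span ((\<lambda>x. x ^ (p ^ e)) ` I)"
proof
  show "ring_ideal.span ((\<lambda>x. x ^ (p ^ e)) ` I) \<subseteq> (frobenius_ideal p ^^ e) I"
    by (intro ring_ideal.span_minimal)
      (auto simp: power_mem_frobenius_iter subspace_frobenius_iter assms)
next
  show "(frobenius_ideal p ^^ e) I \<subseteq> ring_ideal.span ((\<lambda>x. x ^ (p ^ e)) ` I)"
  proof (induction e)
    case 0
    show ?case by (simp add: ring_ideal.span_superset)
  next
    case (Suc e)
    have "x ^ p \<in> ring_ideal.span ((\<lambda>x. x ^ (p ^ Suc e)) ` I)"
      if "x \<in> ring_ideal.span ((\<lambda>x. x ^ (p ^ e)) ` I)" for x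
      using that
    proof (induction rule: ring_ideal.span_induct_alt)
      case base
      have "p \<noteq> 0" using assms by auto
      then show ?case by (simp add: power_0_left ring_ideal.span_zero)
    next
      case (step c x y)
      then obtain z where z: "z \<in> I" "x = z ^ (p ^ e)" by auto
      have "x ^ p = z ^ (p ^ Suc e)"
        using z by (simp add: mult.commute flip: power_mult)
      then have "c ^ p * x ^ p \<in> ring_ideal.span ((\<lambda>x. x ^ (p ^ Suc e)) ` I)"
        using z(1) by (metis imageI ring_ideal.span_base ring_ideal.span_scale)
      then show ?case
        using step assms by (simp add: freshmans_dream power_mult_distrib ring_ideal.span_add)
    qed
    then have "frobenius_ideal p (ring_ideal.span ((\<lambda>x. x ^ (p ^ e)) ` I))
        \<subseteq> ring_ideal.span ((\<lambda>x. x ^ (p ^ Suc e)) ` I)"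
      unfolding frobenius_ideal_def[of p "ring_ideal.span _"]
      by (intro ring_ideal.span_minimal) auto
    then show ?case
      using frobenius_ideal_mono[OF Suc.IH, of p] by simp
  qed
qed

text \<open>These are the elements of Hom(F_* R, R): linear maps whose source carries the scalar
  action through Frobenius.\<close>

definition cartier_map :: "nat \<Rightarrow> ('a::comm_ring_1 \<Rightarrow> 'a) \<Rightarrow> bool" where
  "cartier_map p \<phi> \<longleftrightarrow>
     (\<forall>x y. \<phi> (x + y) = \<phi> x + \<phi> y) \<and> (\<forall>r x. \<phi> (r ^ p * x) = r * \<phi> x)"

text \<open>A multiple c z^p of a generator is sent to z times the image of c, which is in I because
  z is.\<close>

lemma cartier_map_frobenius_ideal:
  assumes "cartier_map p \<phi>" "ring_ideal.subspace I" "x \<in> frobenius_ideal p I"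
  shows "\<phi> x \<in> I"
proof -
  interpret Modules.additive \<phi>
    using assms(1) by (auto simp: cartier_map_def Modules.additive_def)
  show ?thesis
    using assms(3) unfolding frobenius_ideal_def
  proof (induction rule: ring_ideal.span_induct_alt)
    case base
    then show ?case using assms(2) by (simp add: zero ring_ideal.subspace_0)
  next
    case (step c x y)
    then obtain z where z: "z \<in> I" "x = z ^ p" by auto
    have "\<phi> (c * x) = z * \<phi> c"
      using assms(1) by (simp add: z mult.commute[of c] cartier_map_def)
    then show ?case
      using step z assms(2) by (simp add: add ring_ideal.subspace_add ideal_mult_right)
  qed
qed

text \<open>
  The dual-basis property of a ring that is free over its \<open>p\<close>-th powers: the Cartier maps in
  \<open>\<Phi>\<close> detect membership in Frobenius powers.
\<close>

locale cartier_ring =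
  fixes p :: nat and \<Phi> :: "('a::comm_ring_1 \<Rightarrow> 'a) set"
  assumes prime_p: "Factorial_Ring.prime p" and CHAR_p: "CHAR('a) = p"
    and cartier: "\<phi> \<in> \<Phi> \<Longrightarrow> cartier_map p \<phi>"
    and detect: "ring_ideal.subspace I \<Longrightarrow> (\<And>\<phi>. \<phi> \<in> \<Phi> \<Longrightarrow> \<phi> x \<in> I) \<Longrightarrow> x \<in> frobenius_ideal p I"
begin

abbreviation F :: "'a set \<Rightarrow> 'a set" where
  "F \<equiv> frobenius_ideal p"

lemma p_gt_1: "p > 1"
  using prime_p prime_gt_1_nat by blast

lemma mem_F_iff: "ring_ideal.subspace I \<Longrightarrow> x \<in> F I \<longleftrightarrow> (\<forall>\<phi>\<in>\<Phi>. \<phi> x \<in> I)"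
  using cartier_map_frobenius_ideal cartier detect by blast

text \<open>Membership in either side says that r times the image of x lies in I for every map in
  \<open>\<Phi>\<close>. This plays the part of flatness of Frobenius.\<close>

lemma F_colon:
  assumes "ring_ideal.subspace I"
  shows "F (colon_ideal I r) = colon_ideal (F I) (r ^ p)"
proof -
  have "\<phi> (r ^ p * x) = r * \<phi> x" if "\<phi> \<in> \<Phi>" for \<phi> x
    using cartier[OF that] by (simp add: cartier_map_def)
  then show ?thesis
    by (auto simp: mem_colon_ideal mem_F_iff assms subspace_colon_ideal)
qed

lemma F_iter_colon:
  assumes "ring_ideal.subspace I"
  shows "(F ^^ e) (colon_ideal I r) = colon_ideal ((F ^^ e) I) (r ^ (p ^ e))"
proof (induction e)
  case (Suc e)
  have "(F ^^ Suc e) (colon_ideal I r) = colon_ideal ((F ^^ Suc e) I) ((r ^ (p ^ e)) ^ p)"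
    using Suc by (simp add: F_colon subspace_frobenius_iter assms)
  then show ?case by (simp add: mult.commute flip: power_mult)
qed simp

text \<open>Membership in F I is a conjunction of conditions on I, one for each map in
  \<open>\<Phi>\<close>, so arbitrary intersections pass through. The least ideal behind
  \<open>frob_root\<close> comes from this.\<close>

lemma F_Inter:
  assumes "\<And>I. I \<in> A \<Longrightarrow> ring_ideal.subspace I"
  shows "F (\<Inter>A) = (\<Inter>I\<in>A. F I)"
proof -
  have "ring_ideal.subspace (\<Inter>A)"
    using assms by (intro ring_ideal.subspace_Inter) auto
  then show ?thesis
    using assms by (auto simp: mem_F_iff)
qed

lemma F_iter_Inter:
  assumes "\<And>I. I \<in> A \<Longrightarrow> ring_ideal.subspace I"
  shows "(F ^^ e) (\<Inter>A) = (\<Inter>I\<in>A. (F ^^ e) I)"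
proof (induction e)
  case (Suc e)
  have "F (\<Inter>((F ^^ e) ` A)) = \<Inter> (F ` ((F ^^ e) ` A))"
    by (rule F_Inter) (auto simp: assms subspace_frobenius_iter)
  then show ?case using Suc by (simp add: image_image)
qed simp

text \<open>The assumption for e + 1 at K is the assumption for e at the colon ideal (F K :
  g^(p-1)); the conclusion obtained there is exactly the premise of \<open>descent\<close> at K.
  This change of K is why P has to be stable under F and under enlargement.\<close>

lemma jacobian_descent_iter:
  assumes F: "\<And>K. P K \<Longrightarrow> P (F K)"
    and upward: "\<And>K L. P K \<Longrightarrow> K \<subseteq> L \<Longrightarrow> ring_ideal.subspace L \<Longrightarrow> P L"
    and descent: "\<And>K. P K \<Longrightarrow> (\<And>j. j \<in> J \<Longrightarrow> g ^ (p - 1) * j \<in> F K) \<Longrightarrow> J \<subseteq> K"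
    and "P K" "\<And>j. j \<in> J \<Longrightarrow> g ^ (p ^ e - 1) * j \<in> (F ^^ e) K"
  shows "J \<subseteq> K"
  using assms(4-)
proof (induction e arbitrary: K)
  case 0
  then show ?case by auto
next
  case (Suc e)
  have sub: "ring_ideal.subspace (F K)" by simp
  have P: "P (colon_ideal (F K) (g ^ (p - 1)))"
    by (rule upward[OF F[OF Suc.prems(1)] subset_colon_ideal[OF sub]])
      (simp add: subspace_colon_ideal)
  \<comment> \<open>All base-p digits of p^(e+1) - 1 equal p - 1; the top digit is split off and
    absorbed into the colon ideal.\<close>
  have pe: "p ^ Suc e - 1 = (p - 1) * p ^ e + (p ^ e - 1)"
  proof -
    have "p ^ Suc e = (p - 1) * p ^ e + p ^ e"
      using p_gt_1 mult_Suc[of "p - 1" "p ^ e"] by (simp del: mult_Suc)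
    moreover have "p ^ e \<ge> 1" using p_gt_1 by simp
    ultimately show ?thesis by linarith
  qed
  have "g ^ (p ^ e - 1) * j \<in> (F ^^ e) (colon_ideal (F K) (g ^ (p - 1)))" if "j \<in> J" for j
  proof -
    have "(g ^ (p - 1)) ^ (p ^ e) * (g ^ (p ^ e - 1) * j) \<in> (F ^^ e) (F K)"
      using Suc.prems(2)[OF that] unfolding pe funpow_Suc_right
      by (simp only: power_add power_mult mult.assoc o_apply)
    then show ?thesis
      by (simp only: F_iter_colon[OF sub] mem_colon_ideal)
  qed
  from Suc.IH[OF P this] have "J \<subseteq> colon_ideal (F K) (g ^ (p - 1))" .
  then show ?case
    by (intro descent[OF Suc.prems(1)]) (auto simp: mem_colon_ideal)
qed

text \<open>
  Writing \<open>a = p\<^bsup>e\<^esup> d + a'\<close>, one has \<open>f\<^bsup>a\<^esup> \<in> K\<^bsup>[p^(e+1)]\<^esup>\<close> iff \<open>f\<^bsup>a'\<^esup> \<in> (K\<^bsup>[p]\<^esup> : f\<^bsup>d\<^esup>)\<^bsup>[p^e]\<^esup>\<close>.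
  If \<open>J \<subseteq> K\<close> this colon ideal is the same for \<open>f\<close> and \<open>g\<close>; if not, neither power can lie in
  \<open>K\<^bsup>[p^(e+1)]\<^esup>\<close> by the descent.
\<close>

lemma frobenius_membership_perturbation:
  assumes ideal: "\<And>K. P K \<Longrightarrow> ring_ideal.subspace K"
    and F: "\<And>K. P K \<Longrightarrow> P (F K)"
    and upward: "\<And>K L. P K \<Longrightarrow> K \<subseteq> L \<Longrightarrow> ring_ideal.subspace L \<Longrightarrow> P L"
    and descent_f: "\<And>K. P K \<Longrightarrow> (\<And>j. j \<in> J \<Longrightarrow> f ^ (p - 1) * j \<in> F K) \<Longrightarrow> J \<subseteq> K"
    and descent_g: "\<And>K. P K \<Longrightarrow> (\<And>j. j \<in> J \<Longrightarrow> g ^ (p - 1) * j \<in> F K) \<Longrightarrow> J \<subseteq> K"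
    and close: "\<And>K. P K \<Longrightarrow> J \<subseteq> K \<Longrightarrow> g - f \<in> F K"
    and "P K" "a < p ^ e"
  shows "f ^ a \<in> (F ^^ e) K \<longleftrightarrow> g ^ a \<in> (F ^^ e) K"
  using assms(7-)
proof (induction e arbitrary: K a)
  case 0
  then show ?case by simp
next
  case (Suc e)
  show ?case
  proof (cases "J \<subseteq> K")
    case True
    define d a' where "d = a div p ^ e" and "a' = a mod p ^ e"
    have a: "a = d * p ^ e + a'" unfolding d_def a'_def by (rule div_mult_mod_eq[symmetric])
    have a': "a' < p ^ e" using p_gt_1 by (simp add: a'_def)
    have sub: "ring_ideal.subspace (F K)" by simp
    have P: "P (colon_ideal (F K) (f ^ d))"
      by (rule upward[OF F[OF Suc.prems(1)] subset_colon_ideal[OF sub]])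
        (simp add: subspace_colon_ideal)
    \<comment> \<open>Stated for any h, since it is used for both f and g; the colon ideals of the
      two are identified afterwards.\<close>
    have reduce: "h ^ a \<in> (F ^^ Suc e) K \<longleftrightarrow> h ^ a' \<in> (F ^^ e) (colon_ideal (F K) (h ^ d))" for h
      by (simp add: a power_add power_mult F_iter_colon mem_colon_ideal funpow_swap1)
    have "g ^ d - f ^ d \<in> F K"
      using ideal_power_diff[OF sub close[OF Suc.prems(1) True]] .
    then have "g ^ d * x - f ^ d * x \<in> F K" for x
      by (simp add: ideal_mult_right flip: left_diff_distrib)
    then have "colon_ideal (F K) (g ^ d) = colon_ideal (F K) (f ^ d)"
      by (metis (no_types, lifting) ideal_add_cancel[OF sub] mem_colon_ideal subsetI subset_antisym)
    then show ?thesis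
      using Suc.IH[OF P a'] by (simp add: reduce del: funpow.simps)
  next
    case False
    have "h ^ a \<notin> (F ^^ Suc e) K"
      if descent: "\<And>K. P K \<Longrightarrow> (\<And>j. j \<in> J \<Longrightarrow> h ^ (p - 1) * j \<in> F K) \<Longrightarrow> J \<subseteq> K" for h
    proof
      assume "h ^ a \<in> (F ^^ Suc e) K"
      \<comment> \<open>Since a < p^(e+1), the power can be raised to exponent p^(e+1) - 1, the one
        at which the iterated descent applies.\<close>
      then have "h ^ a * (h ^ (p ^ Suc e - 1 - a) * j) \<in> (F ^^ Suc e) K" for j
        by (intro ideal_mult_right subspace_frobenius_iter ideal Suc.prems)
      moreover have "h ^ a * (h ^ (p ^ Suc e - 1 - a) * j) = h ^ (p ^ Suc e - 1) * j" for j
        using Suc.prems(2) by (simp add: mult.assoc[symmetric] power_add[symmetric] del: power_Suc)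
      ultimately show False
        using jacobian_descent_iter[where P = P and J = J and g = h and K = K and e = "Suc e",
            OF F upward descent Suc.prems(1)] False
        by (simp del: funpow.simps power_Suc)
    qed
    then show ?thesis using descent_f descent_g by blast
  qed
qed

end


section \<open>Cartier maps on polynomial rings\<close>

abbreviation lookup :: "('a \<Rightarrow>\<^sub>0 'b::zero) \<Rightarrow> 'a \<Rightarrow> 'b" where
  "lookup \<equiv> Poly_Mapping.lookup"

abbreviation keys :: "('a \<Rightarrow>\<^sub>0 'b::zero) \<Rightarrow> 'a set" where
  "keys \<equiv> Poly_Mapping.keys"

abbreviation single :: "'a \<Rightarrow> 'b::zero \<Rightarrow> 'a \<Rightarrow>\<^sub>0 'b" where
  "single \<equiv> Poly_Mapping.single"

lemma CHAR_poly_mapping: "CHAR('a::monoid_add \<Rightarrow>\<^sub>0 'b::semiring_1) = CHAR('b)"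
proof (rule CHAR_eqI)
  show "of_nat CHAR('b) = (0 :: 'a \<Rightarrow>\<^sub>0 'b)"
    by (metis of_nat_CHAR single_of_nat single_zero)
next
  fix n assume "of_nat n = (0 :: 'a \<Rightarrow>\<^sub>0 'b)"
  then have "lookup (of_nat n :: 'a \<Rightarrow>\<^sub>0 'b) 0 = 0" by simp
  then show "CHAR('b) dvd n"
    by (simp add: lookup_of_nat of_nat_eq_0_iff_char_dvd)
qed

lemma sum_single_lookup: "(\<Sum>k\<in>keys f. single k (lookup f k)) = f"
proof (rule poly_mapping_eqI)
  fix k
  have "lookup (\<Sum>k\<in>keys f. single k (lookup f k)) k = (\<Sum>l\<in>keys f. if l = k then lookup f l else 0)"
    by (auto simp: lookup_sum lookup_single when_def intro: sum.cong)
  also have "\<dots> = lookup f k"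
    by (auto simp: in_keys_iff)
  finally show "lookup (\<Sum>k\<in>keys f. single k (lookup f k)) k = lookup f k" .
qed

lemma poly_mapping_additive_induct [case_names zero single add]:
  fixes f :: "'a \<Rightarrow>\<^sub>0 'b::comm_monoid_add"
  assumes "P 0" "\<And>k c. P (single k c)" "\<And>f g. P f \<Longrightarrow> P g \<Longrightarrow> P (f + g)"
  shows "P f"
proof -
  have "P (\<Sum>k\<in>A. single k (lookup f k))" if "finite A" for A
    using that by (induction A rule: finite_induct) (auto intro: assms)
  from this[of "keys f"] show ?thesis by (simp add: sum_single_lookup)
qed

lemma single_sum: "single k (sum f A) = (\<Sum>x\<in>A. single k (f x))"
  by (induction A rule: infinite_finite_induct) (auto simp: single_add)

text \<open>Coordinatewise division with remainder of exponents: x^a is the p-th power of x^(a div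
  p) times x^(a mod p), the remainders being the exponents of the monomial basis over the p-th
  powers of the variables.\<close>

definition scale_exp :: "nat \<Rightarrow> ('n::finite \<Rightarrow>\<^sub>0 nat) \<Rightarrow> ('n \<Rightarrow>\<^sub>0 nat)" where
  "scale_exp n m = Abs_poly_mapping (\<lambda>i. n * lookup m i)"

definition div_exp :: "nat \<Rightarrow> ('n::finite \<Rightarrow>\<^sub>0 nat) \<Rightarrow> ('n \<Rightarrow>\<^sub>0 nat)" where
  "div_exp n m = Abs_poly_mapping (\<lambda>i. lookup m i div n)"

definition mod_exp :: "nat \<Rightarrow> ('n::finite \<Rightarrow>\<^sub>0 nat) \<Rightarrow> ('n \<Rightarrow>\<^sub>0 nat)" where
  "mod_exp n m = Abs_poly_mapping (\<lambda>i. lookup m i mod n)"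

lemma lookup_scale_exp [simp]: "lookup (scale_exp n m) i = n * lookup m i"
  by (simp add: scale_exp_def)

lemma lookup_div_exp [simp]: "lookup (div_exp n m) i = lookup m i div n"
  by (simp add: div_exp_def)

lemma lookup_mod_exp [simp]: "lookup (mod_exp n m) i = lookup m i mod n"
  by (simp add: mod_exp_def)

lemma scale_div_mod_exp: "scale_exp n (div_exp n m) + mod_exp n m = m"
  by (rule poly_mapping_eqI) (simp add: lookup_add)

lemma scale_exp_residue_unique:
  assumes "\<And>i. lookup r i < n" "\<And>i. lookup r' i < n"
    and "scale_exp n a + r = scale_exp n a' + r'"
  shows "a = a' \<and> r = r'"
proof -
  have eq: "n * lookup a i + lookup r i = n * lookup a' i + lookup r' i" for i
    using arg_cong[OF assms(3), of "\<lambda>m. lookup m i"] by (simp add: lookup_add)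
  have "lookup r i = lookup r' i" for i
    using arg_cong[OF eq[of i], of "\<lambda>m. m mod n"] assms(1,2) by simp
  moreover have "lookup a i = lookup a' i" for i
    using eq[of i] calculation[of i] assms(1)[of i] by auto
  ultimately show ?thesis by (auto intro: poly_mapping_eqI)
qed

lemma single_power:
  fixes c :: "'k::comm_semiring_1"
  shows "single a c ^ n = single (scale_exp n a) (c ^ n)"
proof (induction n)
  case 0
  have "scale_exp 0 a = 0" by (rule poly_mapping_eqI) simp
  then show ?case by simp
next
  case (Suc n)
  have "scale_exp (Suc n) a = a + scale_exp n a"
    by (rule poly_mapping_eqI) (simp add: lookup_add)
  then show ?case using Suc by (simp add: mult_single)
qed

text \<open>Write g as the sum over residues r of x^r g_r, with every exponent in g_r divisible by
  p. The projection picks g_r, divides its exponents by p and applies the p^(-1)-linear map L to the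
  coefficients.\<close>

definition cartier_proj ::
    "nat \<Rightarrow> ('k::comm_ring_1 \<Rightarrow> 'k) \<Rightarrow> ('n::finite \<Rightarrow>\<^sub>0 nat) \<Rightarrow> ('n, 'k) mpoly \<Rightarrow> ('n, 'k) mpoly" where
  "cartier_proj p L r g = Abs_poly_mapping (\<lambda>m. L (lookup g (scale_exp p m + r)))"

lemma cartier_map_zero: "cartier_map p L \<Longrightarrow> L 0 = 0"
  by (metis add_cancel_right_right cartier_map_def)

lemma cartier_map_add: "cartier_map p L \<Longrightarrow> L (x + y) = L x + L y"
  by (simp add: cartier_map_def)

lemma cartier_map_mult: "cartier_map p L \<Longrightarrow> L (c ^ p * x) = c * L x"
  by (simp add: cartier_map_def)

lemma lookup_cartier_proj:
  assumes "cartier_map p L" "p > 0"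
  shows "lookup (cartier_proj p L r g) m = L (lookup g (scale_exp p m + r))"
proof -
  have inj: "inj (\<lambda>m. scale_exp p m + r)"
  proof (rule injI)
    fix a b assume "scale_exp p a + r = scale_exp p b + r"
    then have "scale_exp p a = scale_exp p b" by simp
    then have "p * lookup a i = p * lookup b i" for i
      by (metis lookup_scale_exp)
    then show "a = b" using assms(2) by (intro poly_mapping_eqI) auto
  qed
  have "{m. L (lookup g (scale_exp p m + r)) \<noteq> 0} \<subseteq> (\<lambda>m. scale_exp p m + r) -` keys g"
    using cartier_map_zero[OF assms(1)] by (auto simp: in_keys_iff)
  then have "finite {m. L (lookup g (scale_exp p m + r)) \<noteq> 0}"
    using finite_vimageI[OF finite_keys inj] finite_subset by blast
  then show ?thesis by (simp add: cartier_proj_def)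
qed

lemma cartier_proj_add:
  assumes "cartier_map p L" "p > 0"
  shows "cartier_proj p L r (f + g) = cartier_proj p L r f + cartier_proj p L r g"
  by (rule poly_mapping_eqI)
    (simp add: lookup_cartier_proj[OF assms] lookup_add cartier_map_add[OF assms(1)])

lemma cartier_proj_zero:
  assumes "cartier_map p L" "p > 0"
  shows "cartier_proj p L r 0 = 0"
  by (rule poly_mapping_eqI) (simp add: lookup_cartier_proj[OF assms] cartier_map_zero[OF assms(1)])

lemma cartier_proj_single:
  assumes L: "cartier_map p L" "p > 0" and r: "\<And>i. lookup r i < p"
  shows "cartier_proj p L r (single a c) = (if mod_exp p a = r then single (div_exp p a) (L c) else 0)"
proof (rule poly_mapping_eqI)
  fix m
  have "a = scale_exp p m + r \<longleftrightarrow> div_exp p a = m \<and> mod_exp p a = r"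
    using scale_exp_residue_unique[of "mod_exp p a" p r "div_exp p a" m] r L(2)
    by (metis lookup_mod_exp mod_less_divisor scale_div_mod_exp)
  then show "lookup (cartier_proj p L r (single a c)) m =
      lookup (if mod_exp p a = r then single (div_exp p a) (L c) else 0) m"
    by (auto simp: lookup_cartier_proj[OF L] lookup_single when_def cartier_map_zero[OF L(1)])
qed

text \<open>Additivity in g, and in f by the freshman's dream, reduces the claim to monomials. There
  a p-th power shifts the quotient exponent and leaves the residue alone.\<close>

lemma cartier_map_cartier_proj:
  fixes L :: "'k::comm_ring_1 \<Rightarrow> 'k" and r :: "'n::finite \<Rightarrow>\<^sub>0 nat"
  assumes "Factorial_Ring.prime p" "CHAR('k) = p"
    and L: "cartier_map p L" and r: "\<And>i. lookup r i < p"
  shows "cartier_map p (cartier_proj p L r)"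
  unfolding cartier_map_def
proof (intro conjI allI)
  have p: "p > 0" using assms(1) prime_gt_0_nat by blast
  note add = cartier_proj_add[OF L p] and zero = cartier_proj_zero[OF L p]
  have CHAR: "CHAR(('n, 'k) mpoly) = p" using assms by (simp add: CHAR_poly_mapping)
  fix f g :: "('n, 'k) mpoly"
  show "cartier_proj p L r (f + g) = cartier_proj p L r f + cartier_proj p L r g"
    by (rule add)
  show "cartier_proj p L r (f ^ p * g) = f * cartier_proj p L r g"
  proof (induction f rule: poly_mapping_additive_induct)
    case zero
    then show ?case using p by (simp add: power_0_left cartier_proj_zero[OF L p])
  next
    case (add f1 f2)
    then show ?case
      using assms(1) CHAR by (simp add: freshmans_dream distrib_right cartier_proj_add[OF L p])
  next
    case (single a c)
    show ?case
    proof (induction g rule: poly_mapping_additive_induct)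
      case zero
      then show ?case by (simp add: cartier_proj_zero[OF L p])
    next
      case (add g1 g2)
      then show ?case by (simp add: distrib_left cartier_proj_add[OF L p])
    next
      case (single b d)
      have "mod_exp p (scale_exp p a + b) = mod_exp p b"
        by (rule poly_mapping_eqI) (simp add: lookup_add)
      moreover have "div_exp p (scale_exp p a + b) = a + div_exp p b"
        using p by (intro poly_mapping_eqI) (simp add: lookup_add)
      ultimately show ?case
        by (simp add: single_power mult_single cartier_proj_single[OF L p r] cartier_map_mult[OF L])
    qed
  qed
qed

text \<open>This is k as a vector space over its subfield of p-th powers, with k itself as the
  scalar type. Coordinate functions for this action are Cartier maps.\<close>

lemma vector_space_frobenius:
  assumes "Factorial_Ring.prime p" "CHAR('k) = p"
  shows "Vector_Spaces.vector_space (\<lambda>c x :: 'k::field. c ^ p * x)"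
  using assms by unfold_locales (auto simp: algebra_simps freshmans_dream power_mult_distrib)

text \<open>L is the coordinate at 1 for a basis containing 1. The normalization makes L fix the
  integers of k, which appear as coefficients on differentiation.\<close>

lemma exists_normalized_cartier_map:
  assumes "Factorial_Ring.prime p" "CHAR('k) = p"
  obtains L :: "'k::field \<Rightarrow> 'k" where "cartier_map p L" "L 1 = 1"
proof -
  interpret V: Vector_Spaces.vector_space "\<lambda>c x :: 'k. c ^ p * x"
    by (rule vector_space_frobenius[OF assms])
  define B where "B = V.extend_basis {1}"
  have "V.independent {1}"
    by (simp add: V.dependent_single)
  then have B: "V.independent B" "V.span B = UNIV" "1 \<in> B"
    using V.independent_extend_basis V.span_extend_basis V.extend_basis_superset
    unfolding B_def by blast+
  have "cartier_map p (\<lambda>x. V.representation B x 1)"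
    by (simp add: cartier_map_def V.representation_add V.representation_scale B)
  moreover have "V.representation B 1 1 = 1"
    using V.representation_basis[OF B(1) B(3)] by simp
  ultimately show ?thesis using that by blast
qed

text \<open>All elements of Y are expanded in one basis of k over its p-th powers; B collects the
  finitely many basis vectors that occur.\<close>

lemma exists_cartier_coordinates:
  fixes Y :: "'k::field set"
  assumes "Factorial_Ring.prime p" "CHAR('k) = p" "finite Y"
  obtains \<Lambda> :: "'k \<Rightarrow> 'k \<Rightarrow> 'k" and B where
    "finite B" "\<And>b. cartier_map p (\<Lambda> b)" "\<And>x. x \<in> Y \<Longrightarrow> (\<Sum>b\<in>B. \<Lambda> b x ^ p * b) = x"
proof -
  interpret V: Vector_Spaces.vector_space "\<lambda>c x :: 'k. c ^ p * x"
    by (rule vector_space_frobenius[OF assms(1,2)])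
  define E where "E = V.extend_basis {}"
  have E: "V.independent E" "V.span E = UNIV"
    using V.independent_extend_basis[OF V.independent_empty] V.span_extend_basis[OF V.independent_empty]
    unfolding E_def by blast+
  define B where "B = (\<Union>x\<in>Y. {b. V.representation E x b \<noteq> 0})"
  have "p > 0" using assms(1) prime_gt_0_nat by blast
  have fin: "finite B"
    using assms(3) V.finite_representation by (auto simp: B_def)
  have "(\<Sum>b\<in>B. V.representation E x b ^ p * b) = x" if "x \<in> Y" for x
  proof -
    have "(\<Sum>b\<in>B. V.representation E x b ^ p * b) =
        (\<Sum>b | V.representation E x b \<noteq> 0. V.representation E x b ^ p * b)"
      using fin that \<open>p > 0\<close> by (intro sum.mono_neutral_right) (auto simp: B_def power_0_left)
    also have "\<dots> = x"
      using E by (intro V.sum_nonzero_representation_eq) auto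
    finally show ?thesis .
  qed
  moreover have "cartier_map p (\<lambda>x. V.representation E x b)" for b
    by (simp add: cartier_map_def V.representation_add V.representation_scale E)
  ultimately show ?thesis
    using that[OF fin, of "\<lambda>b x. V.representation E x b"] by blast
qed

definition mpoly_cartier_maps :: "nat \<Rightarrow> (('n::finite, 'k::comm_ring_1) mpoly \<Rightarrow> ('n, 'k) mpoly) set" where
  "mpoly_cartier_maps p = {cartier_proj p L r | L r. cartier_map p L \<and> (\<forall>i. lookup r i < p)}"

text \<open>Dual-basis expansion: the products of a monomial x^r, all exponents below p, with a
  basis vector b of k over its p-th powers span, and Cartier maps give the coordinates. An element
  whose Cartier images all lie in I is thereby a combination of p-th powers from I.\<close>

lemma mpoly_frobenius_decomposition:
  fixes g :: "('n::finite, 'k::field) mpoly"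
  assumes "Factorial_Ring.prime p" "CHAR('k) = p"
  obtains \<Lambda> :: "'k \<Rightarrow> ('n \<Rightarrow>\<^sub>0 nat) \<Rightarrow> ('n, 'k) mpoly \<Rightarrow> ('n, 'k) mpoly" and B and R :: "('n \<Rightarrow>\<^sub>0 nat) set" where
    "\<And>b r. b \<in> B \<Longrightarrow> r \<in> R \<Longrightarrow> \<Lambda> b r \<in> mpoly_cartier_maps p"
    "g = (\<Sum>r\<in>R. \<Sum>b\<in>B. \<Lambda> b r g ^ p * single r b)"
proof -
  have p: "p > 0" using assms(1) prime_gt_0_nat by blast
  have CHAR: "CHAR(('n, 'k) mpoly) = p" using assms by (simp add: CHAR_poly_mapping)
  obtain \<Lambda> :: "'k \<Rightarrow> 'k \<Rightarrow> 'k" and B where B: "finite B" and \<Lambda>: "\<And>b. cartier_map p (\<Lambda> b)"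
    and coord: "\<And>x. x \<in> lookup g ` keys g \<Longrightarrow> (\<Sum>b\<in>B. \<Lambda> b x ^ p * b) = x"
    by (rule exists_cartier_coordinates[OF assms, where Y = "lookup g ` keys g"]) auto
  define R where "R = mod_exp p ` keys g"
  have R: "finite R" "\<And>r i. r \<in> R \<Longrightarrow> lookup r i < p"
    using p by (auto simp: R_def)
  \<comment> \<open>T is additive, so T g = g can be checked term by term; R and B come from the
    exponents and coefficients of g and so cover its terms.\<close>
  define T where "T f = (\<Sum>r\<in>R. \<Sum>b\<in>B. cartier_proj p (\<Lambda> b) r f ^ p * single r b)" for f
  have T_add: "T (f + h) = T f + T h" for f h
    using assms(1) CHAR
    by (simp add: T_def cartier_proj_add[OF \<Lambda> p] freshmans_dream distrib_right sum.distrib)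
  have T_zero: "T 0 = 0"
    using p by (simp add: T_def cartier_proj_zero[OF \<Lambda> p] power_0_left)
  have T_sum: "T (sum f A) = (\<Sum>k\<in>A. T (f k))" for f and A :: "('n \<Rightarrow>\<^sub>0 nat) set"
    by (induction A rule: infinite_finite_induct) (auto simp: T_add T_zero)
  have T_single: "T (single k (lookup g k)) = single k (lookup g k)" if "k \<in> keys g" for k
  proof -
    have "T (single k (lookup g k)) =
        (\<Sum>r\<in>R. if r = mod_exp p k
          then (\<Sum>b\<in>B. single (div_exp p k) (\<Lambda> b (lookup g k)) ^ p * single r b) else 0)"
      unfolding T_def using p
      by (intro sum.cong refl) (auto simp: cartier_proj_single[OF \<Lambda> p] R(2) power_0_left)
    also have "\<dots> = (\<Sum>b\<in>B. single (div_exp p k) (\<Lambda> b (lookup g k)) ^ p * single (mod_exp p k) b)"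
      using that R(1) by (simp add: R_def)
    also have "\<dots> = single k (\<Sum>b\<in>B. \<Lambda> b (lookup g k) ^ p * b)"
      by (simp add: single_power mult_single scale_div_mod_exp single_sum)
    also have "\<dots> = single k (lookup g k)"
      using coord[of "lookup g k"] that by auto
    finally show ?thesis .
  qed
  have "T g = (\<Sum>k\<in>keys g. T (single k (lookup g k)))"
    by (subst (1) sum_single_lookup[of g, symmetric]) (rule T_sum)
  also have "\<dots> = g"
    by (simp add: T_single sum_single_lookup)
  finally have "g = (\<Sum>r\<in>R. \<Sum>b\<in>B. cartier_proj p (\<Lambda> b) r g ^ p * single r b)"
    by (simp add: T_def)
  moreover have "cartier_proj p (\<Lambda> b) r \<in> mpoly_cartier_maps p" if "r \<in> R" for b r
    unfolding mpoly_cartier_maps_def using \<Lambda> R(2)[OF that] by blast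
  ultimately show ?thesis
    by (intro that[where \<Lambda> = "\<lambda>b. cartier_proj p (\<Lambda> b)" and B = B and R = R])
qed

lemma cartier_ring_mpoly:
  assumes "Factorial_Ring.prime p" "CHAR('k) = p"
  shows "cartier_ring p (mpoly_cartier_maps p :: (('n::finite, 'k::field) mpoly \<Rightarrow> _) set)"
proof
  show "Factorial_Ring.prime p" by fact
  show "CHAR(('n, 'k) mpoly) = p" using assms by (simp add: CHAR_poly_mapping)
next
  fix \<phi> :: "('n, 'k) mpoly \<Rightarrow> ('n, 'k) mpoly" assume "\<phi> \<in> mpoly_cartier_maps p"
  then show "cartier_map p \<phi>"
    using cartier_map_cartier_proj[OF assms] by (auto simp: mpoly_cartier_maps_def)
next
  fix I and g :: "('n, 'k) mpoly"
  assume I: "ring_ideal.subspace I" and \<phi>: "\<And>\<phi>. \<phi> \<in> mpoly_cartier_maps p \<Longrightarrow> \<phi> g \<in> I"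
  obtain \<Lambda> :: "'k \<Rightarrow> ('n \<Rightarrow>\<^sub>0 nat) \<Rightarrow> ('n, 'k) mpoly \<Rightarrow> ('n, 'k) mpoly" and B and R :: "('n \<Rightarrow>\<^sub>0 nat) set" where
    \<Lambda>: "\<And>b r. b \<in> B \<Longrightarrow> r \<in> R \<Longrightarrow> \<Lambda> b r \<in> mpoly_cartier_maps p" and
    g: "g = (\<Sum>r\<in>R. \<Sum>b\<in>B. \<Lambda> b r g ^ p * single r b)"
    by (rule mpoly_frobenius_decomposition[OF assms, where g = g]) (rule that)
  have "(\<Sum>r\<in>R. \<Sum>b\<in>B. \<Lambda> b r g ^ p * single r b) \<in> frobenius_ideal p I"
    by (intro ring_ideal.subspace_sum ideal_mult_right power_mem_frobenius_ideal \<phi> \<Lambda>) auto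
  then show "g \<in> frobenius_ideal p I" using g by simp
qed


section \<open>Partial derivatives\<close>

lemma lookup_partial_deriv:
  fixes f :: "('n, 'k::comm_ring_1) mpoly"
  shows "lookup (partial_deriv i f) m = of_nat (lookup m i + 1) * lookup f (m + single i 1)"
proof -
  have "lookup (partial_deriv i f) m =
      (\<Sum>a\<in>keys f. lookup (single (a - single i 1) (of_nat (lookup a i) * lookup f a)) m)"
    by (simp add: partial_deriv_def lookup_sum)
  also have "\<dots> = (\<Sum>a\<in>keys f. if a = m + single i 1 then of_nat (lookup a i) * lookup f a else 0)"
  proof (intro sum.cong refl)
    fix a
    \<comment> \<open>Truncated subtraction is injective on exponents with positive i-th entry; all
      others carry the coefficient 0.\<close>
    have "a = m + single i 1" if "a - single i 1 = m" "lookup a i > 0"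
    proof (rule poly_mapping_eqI)
      fix j
      show "lookup a j = lookup (m + single i 1) j"
        using that(2) unfolding that(1)[symmetric]
        by (cases "i = j") (simp_all add: lookup_add lookup_minus lookup_single)
    qed
    then have "a - single i 1 = m \<longleftrightarrow> a = m + single i 1" if "lookup a i > 0"
      using that by (metis add_diff_cancel_right')
    then show "lookup (single (a - single i 1) (of_nat (lookup a i) * lookup f a)) m =
        (if a = m + single i 1 then of_nat (lookup a i) * lookup f a else 0)"
    proof (cases "lookup a i = 0")
      case True
      then have "a \<noteq> m + single i 1" by (auto simp: lookup_add)
      with True show ?thesis by simp
    qed (simp add: lookup_single when_def)
  qed
  also have "\<dots> = of_nat (lookup m i + 1) * lookup f (m + single i 1)"
    by (auto simp: in_keys_iff lookup_add)
  finally show ?thesis .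
qed

lemma partial_deriv_zero [simp]: "partial_deriv i 0 = 0"
  by (rule poly_mapping_eqI) (simp add: lookup_partial_deriv)

lemma partial_deriv_add: "partial_deriv i (f + g) = partial_deriv i f + partial_deriv i g"
  by (rule poly_mapping_eqI) (simp add: lookup_partial_deriv lookup_add distrib_left del: of_nat_Suc)

lemma partial_deriv_sum: "partial_deriv i (sum f A) = (\<Sum>x\<in>A. partial_deriv i (f x))"
  by (induction A rule: infinite_finite_induct) (auto simp: partial_deriv_add)

lemma partial_deriv_single:
  "partial_deriv i (single a c) = single (a - single i 1) (of_nat (lookup a i) * c)"
  by (cases "c = 0") (simp_all add: partial_deriv_def)

lemma partial_deriv_mult:
  fixes f g :: "('n, 'k::comm_ring_1) mpoly"
  shows "partial_deriv i (f * g) = partial_deriv i f * g + f * partial_deriv i g"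
proof (induction f rule: poly_mapping_additive_induct)
  case (single a c)
  show ?case
  proof (induction g rule: poly_mapping_additive_induct)
    case (single b d)
    \<comment> \<open>Subtraction may be moved past a sum only where the i-th entry is positive; in
      the other cases of the split the coefficient vanishes.\<close>
    have sub: "(x + y) - single i 1 = (x - single i 1) + y" if "lookup x i > 0" for x y :: "'n \<Rightarrow>\<^sub>0 nat"
      using that by (intro poly_mapping_eqI) (auto simp: lookup_add lookup_minus lookup_single when_def)
    show ?case
      using sub[of a b] sub[of b a]
      by (cases "lookup a i = 0"; cases "lookup b i = 0")
        (simp_all add: mult_single partial_deriv_single lookup_add add.commute algebra_simps
          flip: single_add)
  qed (simp_all add: partial_deriv_add distrib_left)
qed (simp_all add: partial_deriv_add distrib_right)

lemma partial_deriv_one [simp]: "partial_deriv i 1 = 0"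
  using partial_deriv_single[of i 0 1] by simp

lemma partial_deriv_power:
  "partial_deriv i (f ^ n) = of_nat n * f ^ (n - 1) * partial_deriv i f"
proof (induction n)
  case (Suc n)
  then show ?case
    by (cases n) (simp_all add: partial_deriv_mult algebra_simps)
qed simp

lemma partial_deriv_of_nat_mult: "partial_deriv i (of_nat n * f) = of_nat n * partial_deriv i f"
  by (induction n) (simp_all add: partial_deriv_add distrib_right)

text \<open>
  The operator \<open>f \<mapsto> f\<^bsup>p-1\<^esup> \<partial>\<^sub>i f\<close>, which is formally \<open>\<partial>\<^sub>i (f\<^bsup>p\<^esup> / p)\<close>, is additive modulo derivatives:
  the defect is the derivative of the integral polynomial \<open>((f + g)\<^bsup>p\<^esup> - f\<^bsup>p\<^esup> - g\<^bsup>p\<^esup>) / p\<close>.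
\<close>

lemma power_partial_deriv_add:
  fixes f g :: "('n, 'k::comm_ring_1) mpoly"
  assumes "Factorial_Ring.prime p"
  shows "\<exists>w. (f + g) ^ (p - 1) * partial_deriv i (f + g) =
    f ^ (p - 1) * partial_deriv i f + g ^ (p - 1) * partial_deriv i g + partial_deriv i w"
proof -
  obtain q where p: "p = Suc q" "q > 0"
    using prime_gt_1_nat[OF assms] by (cases p) auto
  define c where "c j = (p choose j) div p" for j
  have c: "p * c j = p choose j" if "0 < j" "j < p" for j
    unfolding c_def using that assms by (intro dvd_mult_div_cancel dvd_choose_prime) auto
  \<comment> \<open>The identities for c are proved in the naturals, where p can be cancelled; in
    the coefficient ring p may be 0.\<close>
  have c1: "j * c j = q choose (j - 1)" if "0 < j" "j < p" for j
  proof -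
    have "p * (j * c j) = p * (q choose (j - 1))"
      using that c[OF that] p(1) times_binomial_minus1_eq[of j p] by (simp add: ac_simps)
    then show ?thesis using prime_gt_0_nat[OF assms] by (metis mult_cancel1 less_numeral_extra(3))
  qed
  have c2: "(p - j) * c j = q choose j" if "0 < j" "j < p" for j
  proof -
    have "p * ((p - j) * c j) = (p - j) * (p choose j)"
      using c[OF that] by (simp add: ac_simps)
    also have "\<dots> = p * (q choose j)"
      using binomial_absorb_comp[of p j] p by simp
    finally show ?thesis using prime_gt_0_nat[OF assms] by (metis mult_cancel1 less_numeral_extra(3))
  qed
  define w where "w = (\<Sum>j=1..q. of_nat (c j) * (f ^ j * g ^ (p - j)))"
  have "partial_deriv i w = (\<Sum>j=1..q. of_nat (q choose (j - 1)) * f ^ (j - 1) * g ^ (q - (j - 1)) * partial_deriv i f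
      + of_nat (q choose j) * f ^ j * g ^ (q - j) * partial_deriv i g)"
    unfolding w_def partial_deriv_sum
  proof (intro sum.cong refl)
    fix j assume j: "j \<in> {1..q}"
    then have j': "0 < j" "j < p" using p by auto
    have e: "p - j - 1 = q - j" "p - j = q - (j - 1)" using j p by auto
    have "partial_deriv i (of_nat (c j) * (f ^ j * g ^ (p - j))) =
        of_nat (j * c j) * f ^ (j - 1) * g ^ (p - j) * partial_deriv i f
        + of_nat ((p - j) * c j) * f ^ j * g ^ (p - j - 1) * partial_deriv i g"
      unfolding partial_deriv_of_nat_mult
      unfolding partial_deriv_mult partial_deriv_power of_nat_mult
      by (simp only: distrib_left mult.assoc mult.commute mult.left_commute)
    then show "partial_deriv i (of_nat (c j) * (f ^ j * g ^ (p - j))) =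
        of_nat (q choose (j - 1)) * f ^ (j - 1) * g ^ (q - (j - 1)) * partial_deriv i f
        + of_nat (q choose j) * f ^ j * g ^ (q - j) * partial_deriv i g"
      unfolding c1[OF j'] c2[OF j'] unfolding e(1) unfolding e(2) .
  qed
  also have "\<dots> = (\<Sum>j=1..q. of_nat (q choose (j - 1)) * f ^ (j - 1) * g ^ (q - (j - 1))) * partial_deriv i f
      + (\<Sum>j=1..q. of_nat (q choose j) * f ^ j * g ^ (q - j)) * partial_deriv i g"
    by (simp add: sum.distrib sum_distrib_right)
  \<comment> \<open>Each sum is the binomial expansion of (f + g)^q short of one term: f^q at the
    upper end here, g^q at the lower end in the other.\<close>
  also have "(\<Sum>j=1..q. of_nat (q choose (j - 1)) * f ^ (j - 1) * g ^ (q - (j - 1)))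
      = (\<Sum>j<q. of_nat (q choose j) * f ^ j * g ^ (q - j))"
    by (rule sum.reindex_bij_witness[of _ Suc "\<lambda>j. j - 1"]) auto
  also have "\<dots> = (f + g) ^ q - f ^ q"
    unfolding binomial_ring lessThan_Suc_atMost[symmetric] by simp
  also have "(\<Sum>j=1..q. of_nat (q choose j) * f ^ j * g ^ (q - j)) = (f + g) ^ q - g ^ q"
    unfolding binomial_ring using sum.atLeast_Suc_atMost[of 0 q "\<lambda>j. of_nat (q choose j) * f ^ j * g ^ (q - j)"]
    by (simp add: atMost_atLeast0)
  finally have "partial_deriv i w = ((f + g) ^ q - f ^ q) * partial_deriv i f + ((f + g) ^ q - g ^ q) * partial_deriv i g" .
  then have "(f + g) ^ (p - 1) * partial_deriv i (f + g) =
    f ^ (p - 1) * partial_deriv i f + g ^ (p - 1) * partial_deriv i g + partial_deriv i w"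
    by (simp add: p partial_deriv_add algebra_simps)
  then show ?thesis by blast
qed

lemma cartier_map_of_nat:
  assumes "cartier_map p L" "L 1 = 1"
  shows "L (of_nat n) = of_nat n"
  by (induction n) (simp_all add: cartier_map_zero[OF assms(1)] cartier_map_add[OF assms(1)] assms(2))

text \<open>A term of the derivative whose exponent at i is -1 modulo p comes from an exponent
  divisible by p, and that exponent is its coefficient.\<close>

lemma cartier_proj_partial_deriv:
  fixes f :: "('n::finite, 'k::comm_ring_1) mpoly"
  assumes "Factorial_Ring.prime p" "CHAR('k) = p" "cartier_map p L"
  shows "cartier_proj p L (single i (p - 1)) (partial_deriv i f) = 0"
proof (rule poly_mapping_eqI)
  fix m
  have p: "p > 0" using assms(1) prime_gt_0_nat by blast
  have "p dvd lookup (scale_exp p m + single i (p - 1)) i + 1"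
    using p by (simp add: lookup_add)
  then have "(of_nat (lookup (scale_exp p m + single i (p - 1)) i + 1) :: 'k) = 0"
    using assms(2) of_nat_eq_0_iff_char_dvd by blast
  then show "lookup (cartier_proj p L (single i (p - 1)) (partial_deriv i f)) m = lookup 0 m"
    by (simp add: lookup_cartier_proj[OF assms(3) p] lookup_partial_deriv cartier_map_zero[OF assms(3)]
        del: of_nat_Suc of_nat_add)
qed

text \<open>Additivity modulo derivatives, which the projection kills, leaves the monomials c x^a.
  There the argument is a_i c^p times x to the exponent p a - e_i = p (a - e_i) + (p-1) e_i, and L
  sends a_i c^p to a_i c since L 1 = 1.\<close>

lemma cartier_proj_power_partial_deriv:
  fixes f :: "('n::finite, 'k::comm_ring_1) mpoly"
  assumes "Factorial_Ring.prime p" "CHAR('k) = p" "cartier_map p L" "L 1 = 1"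
  shows "cartier_proj p L (single i (p - 1)) (f ^ (p - 1) * partial_deriv i f) = partial_deriv i f"
proof -
  have p: "p > 1" using assms(1) prime_gt_1_nat by blast
  then have p0: "p > 0" by simp
  show ?thesis
  proof (induction f rule: poly_mapping_additive_induct)
    case zero
    then show ?case by (simp add: cartier_proj_zero[OF assms(3) p0])
  next
    case (add f g)
    obtain w where w: "(f + g) ^ (p - 1) * partial_deriv i (f + g) =
        f ^ (p - 1) * partial_deriv i f + g ^ (p - 1) * partial_deriv i g + partial_deriv i w"
      using power_partial_deriv_add[OF assms(1), of f g i] by (elim exE)
    show ?case
      unfolding w cartier_proj_add[OF assms(3) p0] cartier_proj_partial_deriv[OF assms(1-3)] add.IH
      by (simp add: partial_deriv_add)
  next
    case (single a c)
    show ?case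
    proof (cases "lookup a i = 0")
      case True
      then show ?thesis by (simp add: partial_deriv_single cartier_proj_zero[OF assms(3) p0])
    next
      case False
      have exp: "scale_exp (p - 1) a + (a - single i 1) = scale_exp p (a - single i 1) + single i (p - 1)"
        using False p
        by (intro poly_mapping_eqI)
          (auto simp: lookup_add lookup_minus lookup_single when_def algebra_simps diff_mult_distrib)
      have r: "\<And>j. lookup (single i (p - 1)) j < p"
        using p by (simp add: lookup_single when_def)
      have unique: "div_exp p (scale_exp p b + single i (p - 1)) = b"
        "mod_exp p (scale_exp p b + single i (p - 1)) = single i (p - 1)" for b
        using p by (auto intro!: poly_mapping_eqI simp: lookup_add lookup_single when_def)
      have "c ^ (p - 1) * (of_nat (lookup a i) * c) = c ^ p * of_nat (lookup a i)"
        using p0 by (simp add: power_eq_if ac_simps)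
      then have "single a c ^ (p - 1) * partial_deriv i (single a c) =
          single (scale_exp p (a - single i 1) + single i (p - 1)) (c ^ p * of_nat (lookup a i))"
        by (simp only: partial_deriv_single single_power mult_single exp)
      then show ?thesis
        by (simp only: cartier_proj_single[OF assms(3) p0 r] unique cartier_map_mult[OF assms(3)]
            cartier_map_of_nat[OF assms(3,4)] partial_deriv_single mult.commute if_True refl)
    qed
  qed
qed


section \<open>The polynomial ring as a ring with carrier\<close>

lemma ring_on_simps [simp]:
  "carrier (ring_on A) = A" "x \<otimes>\<^bsub>ring_on A\<^esub> y = x * y" "\<one>\<^bsub>ring_on A\<^esub> = 1"
  "\<zero>\<^bsub>ring_on A\<^esub> = 0" "x \<oplus>\<^bsub>ring_on A\<^esub> y = x + y"
  by (simp_all add: ring_on_def)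

lemma ring_on_pow [simp]: "x [^]\<^bsub>ring_on A\<^esub> (n::nat) = x ^ n"
  by (induction n) (simp_all add: mult.commute)

definition subring_set :: "'a::comm_ring_1 set \<Rightarrow> bool" where
  "subring_set A \<longleftrightarrow> 1 \<in> A \<and> (\<forall>x\<in>A. \<forall>y\<in>A. x - y \<in> A \<and> x * y \<in> A)"

lemma subring_set_UNIV [simp]: "subring_set UNIV"
  by (simp add: subring_set_def)

lemma subring_set_closed:
  assumes "subring_set A"
  shows "1 \<in> A" "0 \<in> A" "x \<in> A \<Longrightarrow> - x \<in> A" "x \<in> A \<Longrightarrow> y \<in> A \<Longrightarrow> x + y \<in> A"
    "x \<in> A \<Longrightarrow> y \<in> A \<Longrightarrow> x * y \<in> A"
proof -
  show one: "1 \<in> A" using assms by (simp add: subring_set_def)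
  have diff: "x - y \<in> A" if "x \<in> A" "y \<in> A" for x y
    using assms that by (simp add: subring_set_def)
  show zero: "0 \<in> A" using diff[OF one one] by simp
  show minus: "- x \<in> A" if "x \<in> A" for x using diff[OF zero that] by simp
  show "x + y \<in> A" if "x \<in> A" "y \<in> A" using diff[OF that(1) minus[OF that(2)]] by simp
  show "x * y \<in> A" if "x \<in> A" "y \<in> A" using assms that by (simp add: subring_set_def)
qed

lemma cring_ring_on:
  assumes "subring_set A"
  shows "cring (ring_on A)"
proof (rule cringI)
  note closed = subring_set_closed[OF assms]
  show "abelian_group (ring_on A)"
    by (rule abelian_groupI) (auto intro: closed bexI[of _ "- _"] simp: add_ac)
  show "comm_monoid (ring_on A)"
    by (rule comm_monoidI) (auto intro: closed simp: mult_ac)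
qed (simp add: distrib_right)

text \<open>One elementwise criterion for both rings in play: the polynomial ring, which is all of
  its type, and the localization, a proper kind of subring inside the fraction field.\<close>

lemma ideal_ring_on_iff:
  assumes "subring_set A"
  shows "ideal I (ring_on A) \<longleftrightarrow>
    I \<subseteq> A \<and> 0 \<in> I \<and> (\<forall>x\<in>I. \<forall>y\<in>I. x + y \<in> I) \<and> (\<forall>r\<in>A. \<forall>x\<in>I. r * x \<in> I)" (is "_ \<longleftrightarrow> ?R")
proof
  assume "ideal I (ring_on A)"
  then interpret ideal I "ring_on A" .
  show ?R
    using a_subset additive_subgroup.zero_closed[OF is_additive_subgroup]
      additive_subgroup.a_closed[OF is_additive_subgroup] I_l_closed by auto
next
  interpret cring "ring_on A" by (rule cring_ring_on[OF assms])
  note closed = subring_set_closed[OF assms]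
  assume R: ?R
  have minus: "\<ominus>\<^bsub>ring_on A\<^esub> x = - x" if "x \<in> A" for x
    using minus_equality[of "- x" x] that closed by simp
  have neg: "- x \<in> I" if "x \<in> I" for x
  proof -
    have "- 1 * x \<in> I" using R that closed by blast
    then show ?thesis by simp
  qed
  show "ideal I (ring_on A)"
  proof (rule idealI)
    show "ring (ring_on A)" by (rule ring_axioms)
    show "subgroup I (add_monoid (ring_on A))"
    proof (rule add.subgroupI)
      show "I \<subseteq> carrier (ring_on A)" using R by simp
      show "I \<noteq> {}" using R by blast
      show "\<ominus>\<^bsub>ring_on A\<^esub> x \<in> I" if "x \<in> I" for x
        using that R neg by (auto simp: minus subset_iff)
      show "x \<oplus>\<^bsub>ring_on A\<^esub> y \<in> I" if "x \<in> I" "y \<in> I" for x y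
        using that R by simp
    qed
    show "x \<otimes>\<^bsub>ring_on A\<^esub> a \<in> I" if "a \<in> I" "x \<in> carrier (ring_on A)" for a x
      using that R by simp
    then show "a \<otimes>\<^bsub>ring_on A\<^esub> x \<in> I" if "a \<in> I" "x \<in> carrier (ring_on A)" for a x
      using that by (simp add: mult.commute)
  qed
qed

lemma ideal_ring_on_UNIV_iff: "ideal I (ring_on UNIV) \<longleftrightarrow> ring_ideal.subspace I"
  by (simp add: ideal_ring_on_iff ring_ideal.subspace_def)

lemma genideal_ring_on_UNIV: "Idl\<^bsub>ring_on UNIV\<^esub> S = ring_ideal.span S"
  unfolding genideal_def ideal_ring_on_UNIV_iff ring_ideal.span_def hull_def
  by simp

section \<open>Polynomials of order at least a given degree\<close>

definition exp_degree :: "('n::finite \<Rightarrow>\<^sub>0 nat) \<Rightarrow> nat" where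
  "exp_degree a = (\<Sum>i\<in>UNIV. lookup a i)"

lemma exp_degree_add [simp]: "exp_degree (a + b) = exp_degree a + exp_degree b"
  by (simp add: exp_degree_def lookup_add sum.distrib)

lemma exp_degree_zero [simp]: "exp_degree 0 = 0"
  by (simp add: exp_degree_def)

lemma exp_degree_single [simp]: "exp_degree (single i n) = n"
  by (simp add: exp_degree_def lookup_single when_def)

lemma exp_minus_single_add: "lookup a i > 0 \<Longrightarrow> (a - single i 1) + single i 1 = a" for a :: "'n \<Rightarrow>\<^sub>0 nat"
  by (rule poly_mapping_eqI) (auto simp: lookup_add lookup_minus lookup_single when_def)

lemma exp_degree_pos:
  assumes "exp_degree a > 0"
  obtains i where "lookup a i > 0"
  using assms by (force simp: exp_degree_def)

lemma exp_degree_split: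
  assumes "t \<le> exp_degree a"
  shows "\<exists>b c. a = b + c \<and> exp_degree c = t"
  using assms
proof (induction t)
  case 0
  show ?case by (rule exI[of _ a]) simp
next
  case (Suc t)
  then obtain b c where bc: "a = b + c" "exp_degree c = t" by auto
  then obtain i where i: "lookup b i > 0"
    using Suc.prems exp_degree_pos[of b] by auto
  have "a = (b - single i 1) + (c + single i 1)"
    using exp_minus_single_add[OF i] bc(1) by (metis add.assoc add.commute)
  then show ?case using bc(2) by (intro exI[of _ "b - single i 1"] exI[of _ "c + single i 1"]) simp
qed

text \<open>This is m^d described by coefficients; the description makes degree counts on monomials
  immediate.\<close>

definition order_ideal :: "nat \<Rightarrow> ('n::finite, 'k::comm_ring_1) mpoly set" where
  "order_ideal d = {f. \<forall>a\<in>keys f. d \<le> exp_degree a}"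

lemma mem_order_ideal_iff: "f \<in> order_ideal d \<longleftrightarrow> (\<forall>a. exp_degree a < d \<longrightarrow> lookup f a = 0)"
  by (auto simp: order_ideal_def in_keys_iff not_less[symmetric])

lemma single_mem_order_ideal: "d \<le> exp_degree a \<Longrightarrow> single a c \<in> order_ideal d"
  by (auto simp: order_ideal_def)

lemma order_ideal_mult:
  assumes "f \<in> order_ideal d" "g \<in> order_ideal e"
  shows "f * g \<in> order_ideal (d + e)"
  unfolding order_ideal_def mem_Collect_eq
proof
  fix a assume "a \<in> keys (f * g)"
  then obtain b c where bc: "a = b + c" "b \<in> keys f" "c \<in> keys g"
    using keys_mult[of f g] by auto
  then have "d \<le> exp_degree b" "e \<le> exp_degree c"
    using assms by (auto simp: order_ideal_def)
  then show "d + e \<le> exp_degree a"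
    using bc(1) by simp
qed

lemma order_ideal_0 [simp]: "order_ideal 0 = UNIV"
  by (auto simp: order_ideal_def)

lemma subspace_order_ideal [simp]: "ring_ideal.subspace (order_ideal d)"
proof (rule ring_ideal.subspaceI)
  show "c * x \<in> order_ideal d" if "x \<in> order_ideal d" for c x :: "('n::finite, 'k::comm_ring_1) mpoly"
    using order_ideal_mult[of c 0 x d] that by simp
qed (simp_all add: mem_order_ideal_iff lookup_add)

lemma order_ideal_antimono: "d \<le> e \<Longrightarrow> order_ideal e \<subseteq> order_ideal d"
  by (force simp: order_ideal_def)

lemma order_ideal_subsetI:
  assumes "ring_ideal.subspace I" "\<And>a c. d \<le> exp_degree a \<Longrightarrow> single a c \<in> I"
  shows "order_ideal d \<subseteq> I"
proof
  fix f :: "('a, 'b) mpoly" assume "f \<in> order_ideal d"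
  then have "(\<Sum>a\<in>keys f. single a (lookup f a)) \<in> I"
    by (intro ring_ideal.subspace_sum assms) (auto simp: order_ideal_def)
  then show "f \<in> I" by (simp add: sum_single_lookup)
qed

lemma irrelevant_ideal_eq: "irrelevant_ideal = order_ideal 1"
proof -
  have "ring_ideal.span (range mpoly_var) = (order_ideal 1 :: ('n::finite, 'k::comm_ring_1) mpoly set)"
  proof (intro subset_antisym ring_ideal.span_minimal order_ideal_subsetI)
    fix a :: "'n \<Rightarrow>\<^sub>0 nat" and c :: 'k assume "1 \<le> exp_degree a"
    then obtain i where i: "lookup a i > 0" using exp_degree_pos[of a] by auto
    have "single a c = single (a - single i 1) c * mpoly_var i"
      by (simp add: mpoly_var_def mult_single exp_minus_single_add[OF i, simplified])
    then show "single a c \<in> ring_ideal.span (range mpoly_var)"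
      by (simp add: ring_ideal.span_base ring_ideal.span_scale)
  qed (auto simp: mpoly_var_def single_mem_order_ideal)
  then show ?thesis
    by (simp add: irrelevant_ideal_def mpoly_ring_def genideal_ring_on_UNIV)
qed

lemma irrelevant_ideal_power_subset:
  "irrelevant_ideal [^]\<^bsub>ideals_set mpoly_ring\<^esub> (N::nat) \<subseteq>
    (order_ideal N :: ('n::finite, 'k::comm_ring_1) mpoly set)"
proof (induction N)
  case (Suc N)
  let ?P = "irrelevant_ideal [^]\<^bsub>ideals_set mpoly_ring\<^esub> N :: ('n, 'k) mpoly set"
  have "x \<in> order_ideal (Suc N)" if "x \<in> ideal_prod mpoly_ring ?P irrelevant_ideal" for x :: "('n, 'k) mpoly"
    using that
  proof induction
    case (prod i j)
    then have "i \<in> order_ideal N" "j \<in> order_ideal 1"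
      using Suc by (auto simp: irrelevant_ideal_eq)
    from order_ideal_mult[OF this] show ?case by (simp add: mpoly_ring_def)
  next
    case (sum s1 s2)
    then show ?case by (simp add: mpoly_ring_def ring_ideal.subspace_add)
  qed
  then show ?case by (auto simp: ideals_set_def)
qed simp

section \<open>Sums of ideals, Nakayama's lemma and ideals containing a power of m\<close>

definition ideal_sum :: "'a::comm_ring_1 set \<Rightarrow> 'a set \<Rightarrow> 'a set" where
  "ideal_sum I I' = {x + y | x y. x \<in> I \<and> y \<in> I'}"

lemma subspace_ideal_sum:
  assumes "ring_ideal.subspace I" "ring_ideal.subspace I'"
  shows "ring_ideal.subspace (ideal_sum I I')"
proof -
  have "ideal_sum I I' = ring_ideal.span (I \<union> I')"
    using assms by (simp add: ideal_sum_def ring_ideal.span_Un ring_ideal.span_eq_iff[THEN iffD2])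
  then show ?thesis by simp
qed

lemma ideal_sum_subset_iff:
  assumes "ring_ideal.subspace I" "ring_ideal.subspace I'" "ring_ideal.subspace K"
  shows "ideal_sum I I' \<subseteq> K \<longleftrightarrow> I \<subseteq> K \<and> I' \<subseteq> K"
proof
  assume sum: "ideal_sum I I' \<subseteq> K"
  have "x + 0 \<in> ideal_sum I I'" if "x \<in> I" for x
    using that ring_ideal.subspace_0[OF assms(2)] unfolding ideal_sum_def by blast
  moreover have "0 + y \<in> ideal_sum I I'" if "y \<in> I'" for y
    using that ring_ideal.subspace_0[OF assms(1)] unfolding ideal_sum_def by blast
  ultimately show "I \<subseteq> K \<and> I' \<subseteq> K" using sum by auto
qed (auto simp: ideal_sum_def intro: ring_ideal.subspace_add[OF assms(3)])

text \<open>Multiplying the assumption by monomials of degree t pushes the error from order d + t to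
  order d + t + 1. Once the order reaches M, the error lies in K; the bound M replaces localness of
  the ring.\<close>

lemma order_ideal_nakayama:
  fixes K :: "('n::finite, 'k::comm_ring_1) mpoly set"
  assumes K: "ring_ideal.subspace K" and M: "order_ideal M \<subseteq> K"
    and d: "order_ideal d \<subseteq> ideal_sum K (order_ideal (Suc d))"
  shows "order_ideal d \<subseteq> K"
proof -
  have "order_ideal d \<subseteq> ideal_sum K (order_ideal (d + t))" for t
  proof (induction t)
    case 0
    show ?case using ring_ideal.subspace_0[OF K] by (force simp: ideal_sum_def)
  next
    case (Suc t)
    let ?S = "ideal_sum K (order_ideal (Suc (d + t)))"
    have S: "ring_ideal.subspace ?S" by (simp add: subspace_ideal_sum K)
    have KS: "K \<subseteq> ?S" "order_ideal (Suc (d + t)) \<subseteq> ?S"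
      using ideal_sum_subset_iff[OF K _ S, of "order_ideal (Suc (d + t))"] by auto
    have "order_ideal (d + t) \<subseteq> ?S"
    proof (rule order_ideal_subsetI[OF S])
      fix a :: "'n \<Rightarrow>\<^sub>0 nat" and c :: 'k assume "d + t \<le> exp_degree a"
      then obtain b b' where b: "a = b + b'" "exp_degree b' = t"
        using exp_degree_split[of t a] by auto
      then have "single b c \<in> order_ideal d"
        using \<open>d + t \<le> exp_degree a\<close> by (simp add: single_mem_order_ideal)
      then obtain x y where xy: "single b c = x + y" "x \<in> K" "y \<in> order_ideal (Suc d)"
        using d by (auto simp: ideal_sum_def)
      have "single b' 1 * y \<in> order_ideal (Suc (d + t))"
        using order_ideal_mult[OF single_mem_order_ideal[of t b' 1] xy(3)] b(2) by (simp add: add.commute)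
      then have "single b' 1 * x + single b' 1 * y \<in> ?S"
        using ring_ideal.subspace_scale[OF K xy(2)] KS
        by (intro ring_ideal.subspace_add[OF S]) auto
      also have "single b' 1 * x + single b' 1 * y = single a c"
        using b(1) by (simp add: mult_single add.commute flip: xy(1) distrib_left)
      finally show "single a c \<in> ?S" .
    qed
    then have "ideal_sum K (order_ideal (d + t)) \<subseteq> ?S"
      using ideal_sum_subset_iff[OF K _ S, of "order_ideal (d + t)"] KS by auto
    then show ?case using Suc by simp
  qed
  moreover have "ideal_sum K (order_ideal (d + M)) \<subseteq> K"
    using ideal_sum_subset_iff[OF K _ K, of "order_ideal (d + M)"] M order_ideal_antimono[of M "d + M"]
    by auto
  ultimately show ?thesis by blast
qed

text \<open>For a monomial of degree at least N the remainder exponents modulo p account for at most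
  n (p-1), so the quotient monomial, which enters as a p-th power, has degree at least M. The
  summand p on the right of the assumption is the gain from rounding up.\<close>

lemma order_ideal_subset_frobenius_ideal:
  assumes "p > 0" "p * M + CARD('n) * (p - 1) < N + p"
  shows "order_ideal N \<subseteq> frobenius_ideal p (order_ideal M :: ('n::finite, 'k::comm_ring_1) mpoly set)"
proof (rule order_ideal_subsetI)
  fix a :: "'n \<Rightarrow>\<^sub>0 nat" and c :: 'k assume a: "N \<le> exp_degree a"
  have "exp_degree a = p * exp_degree (div_exp p a) + exp_degree (mod_exp p a)"
    by (simp add: exp_degree_def sum_distrib_left flip: sum.distrib)
  also have "exp_degree (mod_exp p a) \<le> CARD('n) * (p - 1)"
    unfolding exp_degree_def
    using assms(1) sum_bounded_above[of UNIV "\<lambda>i. lookup (mod_exp p a) i" "p - 1"]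
    by (simp add: Suc_leI less_Suc_eq_le[symmetric])
  finally have "p * M < p * (exp_degree (div_exp p a) + 1)"
    using a assms(2) by simp
  then have "M < exp_degree (div_exp p a) + 1" by (simp only: mult_less_cancel1)
  then have "M \<le> exp_degree (div_exp p a)" by simp
  then have "single (div_exp p a) 1 ^ p * single (mod_exp p a) c \<in>
      frobenius_ideal p (order_ideal M :: ('n, 'k) mpoly set)"
    by (intro ideal_mult_right power_mem_frobenius_ideal single_mem_order_ideal) simp_all
  then show "single a c \<in> frobenius_ideal p (order_ideal M :: ('n, 'k) mpoly set)"
    by (simp add: single_power mult_single scale_div_mod_exp)
qed simp

text \<open>Ideals primary to m, together with the whole ring; including the latter makes the
  condition closed under enlargement, hence under colon ideals.\<close>

definition primary_to_origin :: "('n::finite, 'k::comm_ring_1) mpoly set \<Rightarrow> bool" where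
  "primary_to_origin K \<longleftrightarrow> ring_ideal.subspace K \<and> (\<exists>M. order_ideal M \<subseteq> K)"

lemma primary_to_origin_frobenius:
  assumes "p > 0" "primary_to_origin (K :: ('n::finite, 'k::comm_ring_1) mpoly set)"
  shows "primary_to_origin (frobenius_ideal p K)"
proof -
  obtain M where "order_ideal M \<subseteq> K" using assms(2) by (auto simp: primary_to_origin_def)
  then have "frobenius_ideal p (order_ideal M) \<subseteq> frobenius_ideal p K"
    by (rule frobenius_ideal_mono)
  moreover have "order_ideal (p * M + CARD('n) * (p - 1)) \<subseteq>
      frobenius_ideal p (order_ideal M :: ('n, 'k) mpoly set)"
    using assms(1) by (intro order_ideal_subset_frobenius_ideal) auto
  ultimately have "order_ideal (p * M + CARD('n) * (p - 1)) \<subseteq> frobenius_ideal p K"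
    by (rule subset_trans[rotated])
  then show ?thesis by (auto simp: primary_to_origin_def)
qed

section \<open>The Jacobian ideal\<close>

lemma Jac_eq: "Jac f = ring_ideal.span (insert f (range (\<lambda>i. partial_deriv i f)))"
  by (simp add: Jac_def mpoly_ring_def genideal_ring_on_UNIV)

lemma subspace_Jac [simp]: "ring_ideal.subspace (Jac f)"
  by (simp add: Jac_eq)

lemma Jac_subset_iff:
  assumes "ring_ideal.subspace K"
  shows "Jac f \<subseteq> K \<longleftrightarrow> f \<in> K \<and> (\<forall>i. partial_deriv i f \<in> K)"
proof
  show "f \<in> K \<and> (\<forall>i. partial_deriv i f \<in> K)" if "Jac f \<subseteq> K"
    using that ring_ideal.span_superset[of "insert f (range (\<lambda>i. partial_deriv i f))"]
    by (auto simp: Jac_eq)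
  show "Jac f \<subseteq> K" if "f \<in> K \<and> (\<forall>i. partial_deriv i f \<in> K)"
    unfolding Jac_eq using that assms by (intro ring_ideal.span_minimal) auto
qed

text \<open>It suffices to treat generators. For f itself, f^(p-1) f = f^p, and the projection to
  residue 0 sends f^p to f because it sends 1 to 1; the derivatives use the residues (p-1)
  e_i.\<close>

lemma jacobian_descent:
  fixes f :: "('n::finite, 'k::field) mpoly"
  assumes "Factorial_Ring.prime p" "CHAR('k) = p"
    and K: "ring_ideal.subspace K"
    and J: "\<And>j. j \<in> Jac f \<Longrightarrow> f ^ (p - 1) * j \<in> frobenius_ideal p K"
  shows "Jac f \<subseteq> K"
proof -
  obtain L :: "'k \<Rightarrow> 'k" where L: "cartier_map p L" "L 1 = 1"
    by (rule exists_normalized_cartier_map[OF assms(1,2)])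
  have p: "p > 1" using assms(1) prime_gt_1_nat by blast
  then have p0: "p > 0" by simp
  have mem: "f \<in> Jac f" "partial_deriv i f \<in> Jac f" for i
    using Jac_subset_iff[of "Jac f" f] by auto
  have cartier: "cartier_map p (cartier_proj p L r)" if "\<And>i. lookup r i < p" for r :: "'n \<Rightarrow>\<^sub>0 nat"
    by (rule cartier_map_cartier_proj[OF assms(1,2) L(1) that])
  have "f ^ p * 1 \<in> frobenius_ideal p K"
    using J[OF mem(1)] p by (simp add: power_eq_if mult.commute)
  then have "cartier_proj p L 0 (f ^ p * 1) \<in> K"
    by (intro cartier_map_frobenius_ideal[OF cartier K]) (use p in auto)
  moreover have "cartier_proj p L 0 1 = (1 :: ('n, 'k) mpoly)"
  proof -
    have "mod_exp p 0 = (0 :: 'n \<Rightarrow>\<^sub>0 nat)" "div_exp p 0 = (0 :: 'n \<Rightarrow>\<^sub>0 nat)"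
      by (auto intro: poly_mapping_eqI)
    then show ?thesis
      using cartier_proj_single[OF L(1) p0, of "0 :: 'n \<Rightarrow>\<^sub>0 nat" 0 1] p L(2) by simp
  qed
  moreover have "cartier_proj p L 0 (f ^ p * 1) = f * cartier_proj p L 0 1"
    by (rule cartier_map_mult[OF cartier]) (use p in auto)
  ultimately have "f \<in> K" by simp
  moreover have "partial_deriv i f \<in> K" for i
  proof -
    have "cartier_proj p L (single i (p - 1)) (f ^ (p - 1) * partial_deriv i f) \<in> K"
      by (intro cartier_map_frobenius_ideal[OF cartier K] J mem) (use p in \<open>auto simp: lookup_single when_def\<close>)
    then show ?thesis by (simp only: cartier_proj_power_partial_deriv[OF assms(1,2) L])
  qed
  ultimately show ?thesis by (simp add: Jac_subset_iff K)
qed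

text \<open>Modulo F S, with S = K + (order >= l+1), f and f + h coincide, so the descent for f
  yields \<open>Jac f\<close> inside S. As (order >= l) is in \<open>Jac f\<close>, it lies in K up
  to order l+1, hence in K by Nakayama. Then S collapses to K.\<close>

lemma jacobian_descent_perturbed:
  fixes f h :: "('n::finite, 'k::field) mpoly"
  assumes "Factorial_Ring.prime p" "CHAR('k) = p"
    and l: "order_ideal l \<subseteq> Jac f" and h: "h \<in> frobenius_ideal p (order_ideal (Suc l))"
    and K: "primary_to_origin K"
    and J: "\<And>j. j \<in> Jac f \<Longrightarrow> (f + h) ^ (p - 1) * j \<in> frobenius_ideal p K"
  shows "Jac f \<subseteq> K"
proof -
  obtain M where K': "ring_ideal.subspace K" "order_ideal M \<subseteq> K"
    using K by (auto simp: primary_to_origin_def)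
  define S where "S = ideal_sum K (order_ideal (Suc l))"
  have S: "ring_ideal.subspace S" by (simp add: S_def subspace_ideal_sum K')
  have KS: "K \<subseteq> S" "order_ideal (Suc l) \<subseteq> S"
    using ideal_sum_subset_iff[OF K'(1) _ S, of "order_ideal (Suc l)"] by (auto simp: S_def)
  have "f + h - f \<in> frobenius_ideal p S"
    using h frobenius_ideal_mono[OF KS(2)] by auto
  then have diff: "(f + h) ^ (p - 1) - f ^ (p - 1) \<in> frobenius_ideal p S"
    by (rule ideal_power_diff[OF subspace_frobenius_ideal])
  have "f ^ (p - 1) * j \<in> frobenius_ideal p S" if "j \<in> Jac f" for j
  proof -
    have "(f + h) ^ (p - 1) * j - f ^ (p - 1) * j \<in> frobenius_ideal p S"
      using ideal_mult_right[OF subspace_frobenius_ideal diff] by (simp add: left_diff_distrib)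
    then show ?thesis
      using ideal_add_cancel[OF subspace_frobenius_ideal] J[OF that] frobenius_ideal_mono[OF KS(1)]
      by blast
  qed
  then have JS: "Jac f \<subseteq> S"
    by (rule jacobian_descent[OF assms(1,2) S])
  then have "order_ideal l \<subseteq> K"
    using order_ideal_nakayama[OF K', of l] l by (auto simp: S_def)
  then have "order_ideal (Suc l) \<subseteq> K"
    using order_ideal_antimono[of l "Suc l"] by auto
  then have "S \<subseteq> K"
    using ideal_sum_subset_iff[OF K'(1) _ K'(1), of "order_ideal (Suc l)"] by (simp add: S_def)
  then show ?thesis using JS by simp
qed


section \<open>The length of a quotient of the polynomial ring\<close>

lemma quotient_ring_on_UNIV:
  fixes I :: "'a::comm_ring_1 set"
  assumes "ring_ideal.subspace I"
  defines "q \<equiv> a_r_coset (ring_on UNIV) I"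
  shows "q x = q y \<longleftrightarrow> x - y \<in> I"
    and "carrier (ring_on UNIV Quot I) = range q"
    and "q x \<oplus>\<^bsub>ring_on UNIV Quot I\<^esub> q y = q (x + y)"
    and "q x \<otimes>\<^bsub>ring_on UNIV Quot I\<^esub> q y = q (x * y)"
    and "\<zero>\<^bsub>ring_on UNIV Quot I\<^esub> = q 0"
proof -
  interpret ideal I "ring_on UNIV"
    using assms(1) by (simp add: ideal_ring_on_UNIV_iff)
  have hom: "q \<in> ring_hom (ring_on UNIV) (ring_on UNIV Quot I)"
    unfolding q_def by (rule rcos_ring_hom)
  have q: "q x = (\<lambda>i. i + x) ` I" for x
    by (auto simp: q_def a_r_coset_def')
  show "q x = q y \<longleftrightarrow> x - y \<in> I"
  proof
    assume "q x = q y"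
    moreover have "0 + x \<in> q x"
      unfolding q using ring_ideal.subspace_0[OF assms(1)] by (rule imageI)
    ultimately obtain i where "i \<in> I" "x = i + y" by (auto simp: q)
    then show "x - y \<in> I" by simp
  next
    have sub: "q x \<subseteq> q y" if "x - y \<in> I" for x y
    proof
      fix z assume "z \<in> q x"
      then obtain i where i: "i \<in> I" "z = i + x" by (auto simp: q)
      have "z = (i + (x - y)) + y" using i by simp
      then show "z \<in> q y"
        unfolding q using ring_ideal.subspace_add[OF assms(1) i(1) that] by blast
    qed
    assume "x - y \<in> I"
    then show "q x = q y"
      using sub[of x y] sub[of y x] ring_ideal.subspace_neg[OF assms(1), of "x - y"] by auto
  qed
  show "carrier (ring_on UNIV Quot I) = range q"
    by (auto simp: FactRing_def A_RCOSETS_def' q_def)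
  show "q x \<oplus>\<^bsub>ring_on UNIV Quot I\<^esub> q y = q (x + y)"
    using ring_hom_add[OF hom, of x y] by simp
  show "q x \<otimes>\<^bsub>ring_on UNIV Quot I\<^esub> q y = q (x * y)"
    using ring_hom_mult[OF hom, of x y] by simp
  show "\<zero>\<^bsub>ring_on UNIV Quot I\<^esub> = q 0"
    by (simp add: FactRing_def q)
qed

lemma quotient_module_simps:
  "subgroup N (add_monoid (quotient_module R I)) \<longleftrightarrow> subgroup N (add_monoid (R Quot I))"
  "r \<odot>\<^bsub>quotient_module R I\<^esub> x = (I +>\<^bsub>R\<^esub> r) \<otimes>\<^bsub>R Quot I\<^esub> x"
  by (simp_all add: quotient_module_def subgroup_def m_inv_def)

lemma submodule_image_coset:
  fixes I K :: "'a::comm_ring_1 set"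
  assumes I: "ring_ideal.subspace I" and K: "ring_ideal.subspace K"
  shows "submodule (a_r_coset (ring_on UNIV) I ` K) (ring_on UNIV) (quotient_module (ring_on UNIV) I)"
proof -
  define q where "q = a_r_coset (ring_on UNIV) I"
  note quotient = quotient_ring_on_UNIV[OF I, folded q_def]
  interpret ideal I "ring_on UNIV" using I by (simp add: ideal_ring_on_UNIV_iff)
  interpret Q: ring "ring_on UNIV Quot I" by (rule quotient_is_ring)
  have "subgroup (q ` K) (add_monoid (ring_on UNIV Quot I))"
  proof (rule Q.add.subgroupI)
    show "q ` K \<subseteq> carrier (ring_on UNIV Quot I)" by (auto simp: quotient)
    show "q ` K \<noteq> {}" using ring_ideal.subspace_0[OF K] by auto
    show "\<ominus>\<^bsub>ring_on UNIV Quot I\<^esub> C \<in> q ` K" if C: "C \<in> q ` K" for C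
    proof -
      obtain x where x: "x \<in> K" "C = q x" using C by auto
      have "\<ominus>\<^bsub>ring_on UNIV Quot I\<^esub> q x = q (- x)"
        by (rule Q.minus_equality) (auto simp: quotient)
      then show ?thesis using x ring_ideal.subspace_neg[OF K] by simp
    qed
    show "C \<oplus>\<^bsub>ring_on UNIV Quot I\<^esub> D \<in> q ` K" if "C \<in> q ` K" "D \<in> q ` K" for C D
      using that ring_ideal.subspace_add[OF K] by (auto simp: quotient)
  qed
  then show ?thesis
    unfolding submodule_def submodule_axioms_def quotient_module_simps q_def[symmetric]
    using ring_ideal.subspace_scale[OF K] by (auto simp: quotient)
qed

lemma submodule_vimage_coset:
  fixes I :: "'a::comm_ring_1 set"
  assumes I: "ring_ideal.subspace I"
    and N: "submodule N (ring_on UNIV) (quotient_module (ring_on UNIV) I)"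
  shows "ring_ideal.subspace (a_r_coset (ring_on UNIV) I -` N)" "I \<subseteq> a_r_coset (ring_on UNIV) I -` N"
    "N \<subseteq> range (a_r_coset (ring_on UNIV) I)"
proof -
  define q where "q = a_r_coset (ring_on UNIV) I"
  note quotient = quotient_ring_on_UNIV[OF I, folded q_def]
  have sub: "subgroup N (add_monoid (ring_on UNIV Quot I))"
    using N by (simp add: submodule_def quotient_module_simps)
  have zero: "q 0 \<in> N" using subgroup.one_closed[OF sub] by (simp add: quotient)
  have "ring_ideal.subspace (q -` N)"
  proof (rule ring_ideal.subspaceI)
    show "x + y \<in> q -` N" if "x \<in> q -` N" "y \<in> q -` N" for x y
      using subgroup.m_closed[OF sub, of "q x" "q y"] that by (simp add: quotient)
    show "c * x \<in> q -` N" if "x \<in> q -` N" for c x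
      using submodule.smult_closed[OF N, of c "q x"] that
      by (simp add: quotient_module_simps quotient flip: q_def)
  qed (simp add: zero)
  moreover have "x \<in> q -` N" if "x \<in> I" for x
    using that zero quotient(1)[of x 0] by simp
  moreover have "N \<subseteq> range q"
    using subgroup.subset[OF sub] by (simp add: quotient)
  ultimately show "ring_ideal.subspace (a_r_coset (ring_on UNIV) I -` N)"
    "I \<subseteq> a_r_coset (ring_on UNIV) I -` N" "N \<subseteq> range (a_r_coset (ring_on UNIV) I)"
    unfolding q_def by auto
qed

definition ideal_chain :: "'a::comm_ring_1 set \<Rightarrow> nat \<Rightarrow> (nat \<Rightarrow> 'a set) \<Rightarrow> bool" where
  "ideal_chain I k K \<longleftrightarrow>
     (\<forall>i\<le>k. ring_ideal.subspace (K i) \<and> I \<subseteq> K i) \<and> (\<forall>i<k. K i \<subset> K (Suc i))"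

text \<open>Preimage and image under the quotient map match submodules of R/I with ideals above I.
  Strictness survives preimages by surjectivity, and images because the ideals contain I.\<close>

lemma module_length_quotient_ring_on:
  fixes I :: "'a::comm_ring_1 set"
  assumes I: "ring_ideal.subspace I"
  shows "module_length (ring_on UNIV) (quotient_module (ring_on UNIV) I) =
    Sup {enat k | k. \<exists>K. ideal_chain I k K}"
proof -
  let ?M = "quotient_module (ring_on UNIV) I"
  define q where "q = a_r_coset (ring_on UNIV) I"
  note quotient = quotient_ring_on_UNIV[OF I, folded q_def]
  have "(\<exists>N. (\<forall>i\<le>k. submodule (N i) (ring_on UNIV) ?M) \<and> (\<forall>i<k. N i \<subset> N (Suc i))) \<longleftrightarrow>
      (\<exists>K. ideal_chain I k K)" (is "?L \<longleftrightarrow> ?R") for k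
  proof
    assume ?L
    then obtain N where N: "\<And>i. i \<le> k \<Longrightarrow> submodule (N i) (ring_on UNIV) ?M"
      and strict: "\<And>i. i < k \<Longrightarrow> N i \<subset> N (Suc i)" by blast
    note sub = submodule_vimage_coset[OF I N, folded q_def]
    have "q -` N i \<subset> q -` N (Suc i)" if i: "i < k" for i
    proof -
      obtain C where C: "C \<in> N (Suc i)" "C \<notin> N i" using strict[OF i] by blast
      moreover obtain x where "C = q x" using sub(3)[of "Suc i"] C(1) i by auto
      ultimately show ?thesis using strict[OF i] by auto
    qed
    then have "ideal_chain I k (\<lambda>i. q -` N i)"
      unfolding ideal_chain_def using sub(1,2) by simp
    then show ?R by blast
  next
    assume ?R
    then obtain K where K: "\<And>i. i \<le> k \<Longrightarrow> ring_ideal.subspace (K i)" "\<And>i. i \<le> k \<Longrightarrow> I \<subseteq> K i"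
      and strict: "\<And>i. i < k \<Longrightarrow> K i \<subset> K (Suc i)" unfolding ideal_chain_def by blast
    have "q ` K i \<subset> q ` K (Suc i)" if i: "i < k" for i
    proof -
      obtain x where x: "x \<in> K (Suc i)" "x \<notin> K i" using strict[OF i] by blast
      have "q x \<notin> q ` K i"
      proof
        assume "q x \<in> q ` K i"
        then obtain y where y: "y \<in> K i" "x - y \<in> I" using quotient(1) by auto
        then have "(x - y) + y \<in> K i"
          using K[of i] i by (intro ring_ideal.subspace_add) auto
        then show False using x(2) by simp
      qed
      then show ?thesis using x(1) strict[OF i] by auto
    qed
    then show ?L
      using submodule_image_coset[OF I K(1)] unfolding q_def by (intro exI[of _ "\<lambda>i. q ` K i"]) (simp add: q_def)
  qed
  then show ?thesis by (simp add: module_length_def)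
qed

text \<open>
  Truncating at order \<open>M\<close> makes elements of the strict inclusions linearly independent in the span
  of finitely many monomials.
\<close>

lemma ideal_chain_bounded:
  obtains B where "\<And>k K. ideal_chain (order_ideal M :: ('n::finite, 'k::field) mpoly set) k K \<Longrightarrow> k \<le> B"
proof -
  \<comment> \<open>Scalars act as constant polynomials, so every ideal is a subspace.\<close>
  interpret V: Vector_Spaces.vector_space "\<lambda>c f :: ('n, 'k) mpoly. single 0 c * f"
    by unfold_locales (auto simp: algebra_simps single_add mult_single simp flip: mult.assoc)
  define T where "T = (\<lambda>a. single a 1 :: ('n, 'k) mpoly) ` {a. exp_degree a < M}"
  have "finite {a :: 'n \<Rightarrow>\<^sub>0 nat. exp_degree a < M}"
  proof (rule finite_imageD)
    have "lookup a i < M" if "exp_degree a < M" for a :: "'n \<Rightarrow>\<^sub>0 nat" and i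
      using that member_le_sum[of i UNIV "lookup a"] by (simp add: exp_degree_def)
    then have "lookup ` {a :: 'n \<Rightarrow>\<^sub>0 nat. exp_degree a < M} \<subseteq> (\<Pi>\<^sub>E i\<in>UNIV. {..<M})"
      by auto
    then show "finite (lookup ` {a :: 'n \<Rightarrow>\<^sub>0 nat. exp_degree a < M})"
      by (rule finite_subset) (simp add: finite_PiE)
  qed (simp add: inj_on_def)
  then have T: "finite T" by (simp add: T_def)
  have truncate: "\<exists>t\<in>V.span T. f - t \<in> order_ideal M" for f
  proof -
    define t where "t = (\<Sum>a\<in>{a\<in>keys f. exp_degree a < M}. single a (lookup f a))"
    have "single a c \<in> V.span T" if "exp_degree a < M" for a and c :: 'k
    proof -
      have "single 0 c * single a 1 \<in> V.span T"
        by (intro V.span_scale V.span_base) (use that in \<open>simp add: T_def\<close>)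
      then show ?thesis by (simp add: mult_single)
    qed
    then have "t \<in> V.span T" unfolding t_def by (intro V.span_sum) auto
    moreover have "f - t = (\<Sum>a\<in>{a\<in>keys f. \<not> exp_degree a < M}. single a (lookup f a))"
    proof -
      have "{a\<in>keys f. \<not> exp_degree a < M} = keys f - {a\<in>keys f. exp_degree a < M}" by blast
      then have "(\<Sum>a\<in>keys f. single a (lookup f a)) =
          (\<Sum>a\<in>{a\<in>keys f. \<not> exp_degree a < M}. single a (lookup f a)) + t"
        unfolding t_def by (simp only:) (intro sum.subset_diff; simp)
      then show ?thesis unfolding sum_single_lookup by (simp only: diff_eq_eq)
    qed
    then have "f - t \<in> order_ideal M"
      by (auto intro!: ring_ideal.subspace_sum single_mem_order_ideal)
    ultimately show ?thesis by blast
  qed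
  have "k \<le> card T" if "ideal_chain (order_ideal M :: ('n, 'k) mpoly set) k K" for k K
  proof -
    have K: "ring_ideal.subspace (K i)" "order_ideal M \<subseteq> K i" if "i \<le> k" for i
      using \<open>ideal_chain _ k K\<close> that by (auto simp: ideal_chain_def)
    have strict: "K i \<subset> K (Suc i)" if "i < k" for i
      using \<open>ideal_chain _ k K\<close> that by (auto simp: ideal_chain_def)
    have "\<exists>S. finite S \<and> card S = j \<and> V.independent S \<and> S \<subseteq> V.span T \<inter> K j" if "j \<le> k" for j
      using that
    proof (induction j)
      case 0
      show ?case by (intro exI[of _ "{}"]) (simp add: V.independent_empty)
    next
      case (Suc j)
      then obtain S where S: "finite S" "card S = j" "V.independent S" "S \<subseteq> V.span T \<inter> K j" by auto
      obtain x where x: "x \<in> K (Suc j)" "x \<notin> K j" using strict[of j] Suc.prems by auto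
      obtain t where t: "t \<in> V.span T" "x - t \<in> order_ideal M" using truncate by blast
      \<comment> \<open>All members of the chain contain \<open>order_ideal M\<close>, so truncation
        does not change which of them an element belongs to.\<close>
      have tK: "x \<in> K i \<longleftrightarrow> t \<in> K i" if "i \<le> k" for i
        using ideal_add_cancel[OF K(1)[OF that]] K(2)[OF that] t(2) by blast
      have "V.subspace (K j)"
        using K(1)[of j] Suc.prems by (auto simp: V.subspace_def ring_ideal.subspace_def)
      then have "V.span S \<subseteq> K j" using S(4) by (intro V.span_minimal) auto
      then have t': "t \<notin> V.span S" using tK[of j] x(2) Suc.prems by auto
      then have "V.independent (insert t S)" by (intro V.independent_insertI S)
      moreover have "t \<notin> S" using t' V.span_base by blast
      moreover have "insert t S \<subseteq> V.span T \<inter> K (Suc j)"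
        using S(4) t(1) tK[of "Suc j"] x(1) strict[of j] Suc.prems by auto
      ultimately show ?case using S(1,2) by (intro exI[of _ "insert t S"]) simp
    qed
    then obtain S where "finite S" "card S = k" "V.independent S" "S \<subseteq> V.span T \<inter> K k" by blast
    then show ?thesis using V.independent_span_bound[OF T, of S] by auto
  qed
  then show ?thesis using that by blast
qed

text \<open>If two neighbours I + (order >= d) and I + (order >= d+1) with d <= l agreed, Nakayama
  would put (order >= d), hence (order >= l), into I. The steps d = l, ..., 0 give l + 1 strict
  inclusions, one more than a module of length l permits.\<close>

lemma ideal_chain_order_filtration:
  fixes I :: "('n::finite, 'k::comm_ring_1) mpoly set"
  assumes I: "ring_ideal.subspace I" "order_ideal M \<subseteq> I" and l: "\<not> order_ideal l \<subseteq> I"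
  shows "ideal_chain I (Suc l) (\<lambda>i. ideal_sum I (order_ideal (Suc l - i)))"
proof -
  let ?K = "\<lambda>d. ideal_sum I (order_ideal d)"
  have sub: "ring_ideal.subspace (?K d)" for d
    by (simp add: subspace_ideal_sum I)
  have ge: "I \<subseteq> ?K d" "order_ideal d \<subseteq> ?K d" for d
    using ideal_sum_subset_iff[OF I(1) _ sub[of d], of "order_ideal d"] by auto
  have "?K (Suc d) \<subset> ?K d" if "d \<le> l" for d
  proof
    show "?K (Suc d) \<subseteq> ?K d"
      using ideal_sum_subset_iff[OF I(1) _ sub[of d], of "order_ideal (Suc d)"] ge[of d]
        order_ideal_antimono[of d "Suc d"] by auto
    show "?K (Suc d) \<noteq> ?K d"
    proof
      assume "?K (Suc d) = ?K d"
      then have "order_ideal d \<subseteq> ?K (Suc d)" using ge(2)[of d] by simp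
      then have "order_ideal d \<subseteq> I" by (rule order_ideal_nakayama[OF I])
      then show False using l order_ideal_antimono[OF that] by blast
    qed
  qed
  then have "?K (Suc l - i) \<subset> ?K (Suc l - Suc i)" if "i < Suc l" for i
    using that by (metis Suc_diff_le Suc_leI diff_Suc_Suc diff_le_self less_Suc_eq_le)
  then show ?thesis unfolding ideal_chain_def using sub ge(1) by simp
qed

lemma order_ideal_length_subset:
  fixes I :: "('n::finite, 'k::field) mpoly set"
  assumes I: "primary_to_origin I"
    and l: "l = the_enat (module_length mpoly_ring (quotient_module mpoly_ring I))"
  shows "order_ideal l \<subseteq> I"
proof (rule ccontr)
  assume not: "\<not> order_ideal l \<subseteq> I"
  obtain M where I': "ring_ideal.subspace I" "order_ideal M \<subseteq> I"
    using I by (auto simp: primary_to_origin_def)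
  obtain B where B: "\<And>k K. ideal_chain (order_ideal M :: ('n, 'k) mpoly set) k K \<Longrightarrow> k \<le> B"
    by (rule ideal_chain_bounded[where M = M]) (rule that)
  let ?A = "{enat k | k. \<exists>K. ideal_chain I k K}"
  have len: "module_length mpoly_ring (quotient_module mpoly_ring I) = Sup ?A"
    unfolding mpoly_ring_def by (rule module_length_quotient_ring_on[OF I'(1)])
  \<comment> \<open>\<open>the_enat\<close> is informative only at a finite value, so the length
    must be bounded before it can be identified with l.\<close>
  have "k \<le> B" if "ideal_chain I k K" for k K
    using that I'(2) by (intro B[of k K]) (auto simp: ideal_chain_def)
  then have "Sup ?A \<le> enat B" by (intro Sup_least) auto
  then obtain m where "Sup ?A = enat m" by (rule enat_ile[THEN exE])
  then have "Sup ?A = enat l" using l len by simp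
  moreover have "enat (Suc l) \<le> Sup ?A"
    using ideal_chain_order_filtration[OF I' not] by (intro Sup_upper) blast
  ultimately show False by simp
qed

text \<open>Some power k_i of each variable lies in \<open>Jac f\<close>, and a monomial of degree
  at least the sum of the k_i is divisible by one of these powers.\<close>

lemma Jac_primary_to_origin:
  fixes f :: "('n::finite, 'k::comm_ring_1) mpoly"
  assumes "ideal_radical mpoly_ring (Jac f) = irrelevant_ideal"
  shows "primary_to_origin (Jac f)"
proof -
  have "\<exists>k. single (single i k) 1 \<in> Jac f" for i :: 'n
  proof -
    have "mpoly_var i \<in> ideal_radical mpoly_ring (Jac f)"
      unfolding assms irrelevant_ideal_eq by (simp add: mpoly_var_def single_mem_order_ideal)
    then obtain k where "mpoly_var i ^ k \<in> Jac f"
      by (auto simp: ideal_radical_def mpoly_ring_def)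
    moreover have "scale_exp k (single i 1) = single i k"
      by (rule poly_mapping_eqI) (simp add: lookup_single when_def)
    ultimately show ?thesis by (auto simp: mpoly_var_def single_power)
  qed
  then obtain k where k: "\<And>i. single (single i (k i)) 1 \<in> Jac f" by metis
  have "order_ideal (\<Sum>i\<in>UNIV. k i) \<subseteq> Jac f"
  proof (rule order_ideal_subsetI)
    fix a :: "'n \<Rightarrow>\<^sub>0 nat" and c :: 'k
    assume a: "(\<Sum>i\<in>UNIV. k i) \<le> exp_degree a"
    have "\<exists>i. k i \<le> lookup a i"
    proof (rule ccontr)
      assume "\<nexists>i. k i \<le> lookup a i"
      then have "exp_degree a < (\<Sum>i\<in>UNIV. k i)"
        unfolding exp_degree_def by (intro sum_strict_mono) (auto simp: not_le)
      then show False using a by simp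
    qed
    then obtain i where i: "k i \<le> lookup a i" by blast
    have "(a - single i (k i)) + single i (k i) = a"
      using i by (intro poly_mapping_eqI) (auto simp: lookup_add lookup_minus lookup_single when_def)
    then have "single a c = single (a - single i (k i)) c * single (single i (k i)) 1"
      by (simp add: mult_single)
    then show "single a c \<in> Jac f"
      using ring_ideal.subspace_scale[OF subspace_Jac k] by simp
  qed simp
  then show ?thesis by (auto simp: primary_to_origin_def)
qed

lemma Jac_subset_order_ideal:
  fixes f :: "('n::finite, 'k::comm_ring_1) mpoly"
  assumes "ideal_radical mpoly_ring (Jac f) = irrelevant_ideal"
  shows "Jac f \<subseteq> order_ideal 1"
proof
  fix x assume "x \<in> Jac f"
  then have "x \<in> ideal_radical mpoly_ring (Jac f)"
    by (auto simp: ideal_radical_def mpoly_ring_def intro!: exI[of _ 1])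
  then show "x \<in> order_ideal 1" using assms by (simp add: irrelevant_ideal_eq)
qed


section \<open>Test ideals in a localization\<close>

text \<open>The Cartier maps remain on the ring itself. Contraction turns statements about ideals of
  S into statements about ideals on which these maps act.\<close>

locale localized_cartier_ring = cartier_ring p \<Phi>
  for p and \<Phi> :: "('a::idom \<Rightarrow> 'a) set" +
  fixes P :: "'a set"
  assumes P: "ring_ideal.subspace P" "1 \<notin> P" "a * b \<in> P \<Longrightarrow> a \<in> P \<or> b \<in> P"
begin

abbreviation S :: "'a fract ring" where
  "S \<equiv> localization P"

lemma P_zero: "0 \<in> P"
  by (rule ring_ideal.subspace_0[OF P(1)])

lemma nonzero: "b \<notin> P \<Longrightarrow> b \<noteq> 0"
  using P_zero by auto

lemma mult_notin_P: "a \<notin> P \<Longrightarrow> b \<notin> P \<Longrightarrow> a * b \<notin> P"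
  using P(3) by blast

lemma carrier_S: "carrier S = {Fraction_Field.Fract a b | a b. b \<notin> P}"
  by (simp add: localization_def)

lemma Fract_mem_S: "b \<notin> P \<Longrightarrow> Fraction_Field.Fract a b \<in> carrier S"
  by (auto simp: carrier_S)

lemma S_cases:
  assumes "x \<in> carrier S"
  obtains a b where "x = Fraction_Field.Fract a b" "b \<notin> P"
  using assms by (auto simp: carrier_S)

lemma S_eq: "S = ring_on (carrier S)"
  by (simp add: localization_def)

lemma subring_set_S: "subring_set (carrier S)"
  unfolding subring_set_def
proof (intro conjI ballI)
  show "1 \<in> carrier S"
    using Fract_mem_S[OF P(2), of 1] by (simp add: One_fract_def)
next
  fix x y assume "x \<in> carrier S" "y \<in> carrier S"
  then obtain a b c d where xy: "x = Fraction_Field.Fract a b" "b \<notin> P" "y = Fraction_Field.Fract c d" "d \<notin> P"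
    by (metis S_cases)
  then show "x - y \<in> carrier S" "x * y \<in> carrier S"
    using nonzero mult_notin_P by (auto simp: intro!: Fract_mem_S)
qed

lemma ideal_S_iff: "ideal I S \<longleftrightarrow>
    I \<subseteq> carrier S \<and> 0 \<in> I \<and> (\<forall>x\<in>I. \<forall>y\<in>I. x + y \<in> I) \<and> (\<forall>r\<in>carrier S. \<forall>x\<in>I. r * x \<in> I)"
  using ideal_ring_on_iff[OF subring_set_S] by (metis S_eq)

lemma ring_S: "ring S"
  using cring_ring_on[OF subring_set_S] S_eq by (metis cring.axioms(1))

lemma S_pow [simp]: "x [^]\<^bsub>S\<^esub> (n::nat) = x ^ n"
  unfolding localization_def by (rule ring_on_pow)

lemma to_localization_mem: "to_localization a \<in> carrier S"
  unfolding to_localization_def by (rule Fract_mem_S[OF P(2)])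

lemma to_localization_hom:
  "to_localization (a + b) = to_localization a + to_localization b"
  "to_localization (a * b) = to_localization a * to_localization b"
  "to_localization 0 = (0 :: 'a fract)"
  "to_localization 1 = (1 :: 'a fract)"
  for a b :: 'a
  by (simp_all add: to_localization_def One_fract_def Zero_fract_def)

lemma to_localization_power: "to_localization (a ^ n) = to_localization a ^ n" for a :: 'a
  by (induction n) (simp_all add: to_localization_hom)

definition contraction :: "'a fract set \<Rightarrow> 'a set" where
  "contraction I = to_localization -` I"

lemma mem_contraction: "a \<in> contraction I \<longleftrightarrow> to_localization a \<in> I"
  by (simp add: contraction_def)

lemma contraction_Inter: "contraction (\<Inter>A) = \<Inter> (contraction ` A)"
  by (auto simp: mem_contraction)

lemma subspace_contraction:
  assumes "ideal I S"
  shows "ring_ideal.subspace (contraction I)"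
  using assms to_localization_mem
  by (intro ring_ideal.subspaceI) (auto simp: mem_contraction to_localization_hom ideal_S_iff)

lemma Fract_mem_ideal_iff:
  assumes "ideal I S" "b \<notin> P"
  shows "Fraction_Field.Fract a b \<in> I \<longleftrightarrow> a \<in> contraction I"
proof
  have scale: "r * x \<in> I" if "x \<in> I" "r \<in> carrier S" for r x
    using assms(1) that by (simp add: ideal_S_iff)
  assume "Fraction_Field.Fract a b \<in> I"
  then have "to_localization b * Fraction_Field.Fract a b \<in> I"
    by (rule scale[OF _ to_localization_mem])
  moreover have "to_localization b * Fraction_Field.Fract a b = to_localization a"
    using nonzero[OF assms(2)] by (simp add: to_localization_def eq_fract mult.commute)
  ultimately show "a \<in> contraction I"
    by (simp only: mem_contraction)
next
  have scale: "r * x \<in> I" if "x \<in> I" "r \<in> carrier S" for r x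
    using assms(1) that by (simp add: ideal_S_iff)
  assume "a \<in> contraction I"
  then have "Fraction_Field.Fract 1 b * to_localization a \<in> I"
    by (intro scale Fract_mem_S assms(2)) (simp add: mem_contraction)
  then show "Fraction_Field.Fract a b \<in> I"
    by (simp add: to_localization_def)
qed

text \<open>Elements outside P become units in S. Combined with \<open>F_iter_colon\<close>, this
  saturation passes to the Frobenius powers of a contraction.\<close>

lemma colon_contraction:
  assumes I: "ideal I S" and b: "b \<notin> P"
  shows "colon_ideal (contraction I) b = contraction I"
proof -
  have "b * a \<in> contraction I \<longleftrightarrow> a \<in> contraction I" for a
  proof -
    have "b * a \<in> contraction I \<longleftrightarrow> Fraction_Field.Fract (b * a) b \<in> I"
      by (rule Fract_mem_ideal_iff[OF I b, symmetric])
    also have "Fraction_Field.Fract (b * a) b = Fraction_Field.Fract a 1"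
      using nonzero[OF b] by (simp add: eq_fract)
    finally show ?thesis by (simp add: Fract_mem_ideal_iff[OF I P(2)])
  qed
  then show ?thesis by (simp only: set_eq_iff mem_colon_ideal) simp
qed

definition extension :: "'a set \<Rightarrow> 'a fract set" where
  "extension I = {Fraction_Field.Fract a b | a b. a \<in> I \<and> b \<notin> P}"

lemma ideal_extension:
  assumes I: "ring_ideal.subspace I"
  shows "ideal (extension I) S"
  unfolding ideal_S_iff
proof (intro conjI ballI)
  show "extension I \<subseteq> carrier S" by (auto simp: extension_def carrier_S)
  show "0 \<in> extension I"
    unfolding extension_def Zero_fract_def using ring_ideal.subspace_0[OF I] P(2) by blast
next
  fix x y assume "x \<in> extension I" "y \<in> extension I"
  then obtain a b c d where x: "x = Fraction_Field.Fract a b" "a \<in> I" "b \<notin> P"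
    and y: "y = Fraction_Field.Fract c d" "c \<in> I" "d \<notin> P"
    by (auto simp: extension_def)
  have "x + y = Fraction_Field.Fract (a * d + c * b) (b * d)"
    using x y nonzero by simp
  moreover have "a * d + c * b \<in> I"
    using x y I by (intro ring_ideal.subspace_add ideal_mult_right)
  ultimately show "x + y \<in> extension I"
    using mult_notin_P[OF x(3) y(3)] unfolding extension_def by blast
next
  fix r x assume "r \<in> carrier S" "x \<in> extension I"
  then obtain a b c d where x: "x = Fraction_Field.Fract a b" "a \<in> I" "b \<notin> P"
    and r: "r = Fraction_Field.Fract c d" "d \<notin> P"
    by (auto simp: extension_def elim: S_cases)
  have "r * x = Fraction_Field.Fract (c * a) (d * b)"
    using x r by simp
  moreover have "c * a \<in> I"
    using x I by (intro ring_ideal.subspace_scale)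
  ultimately show "r * x \<in> extension I"
    using mult_notin_P[OF r(2) x(3)] unfolding extension_def by blast
qed

lemma mem_contraction_extension:
  "a \<in> contraction (extension I) \<longleftrightarrow> (\<exists>b. b \<notin> P \<and> a * b \<in> I)"
proof
  assume "a \<in> contraction (extension I)"
  then obtain c b where "to_localization a = Fraction_Field.Fract c b" "c \<in> I" "b \<notin> P"
    by (auto simp: mem_contraction extension_def)
  then show "\<exists>b. b \<notin> P \<and> a * b \<in> I"
    using nonzero[of b] by (auto simp: to_localization_def eq_fract)
next
  assume "\<exists>b. b \<notin> P \<and> a * b \<in> I"
  then obtain b where b: "b \<notin> P" "a * b \<in> I" by blast
  have "to_localization a = Fraction_Field.Fract (a * b) b"
    using nonzero[OF b(1)] by (simp add: to_localization_def eq_fract)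
  then show "a \<in> contraction (extension I)"
    using b unfolding mem_contraction extension_def by blast
qed

text \<open>Contraction commutes with Frobenius powers. Clearing denominators gives r b in F^e of
  the contraction for some b outside P; replacing b by b^(p^e) makes it a colon condition that can
  be pulled inside F^e, where b disappears.\<close>

lemma mem_frob_power_iff:
  assumes I: "ideal I S"
  shows "to_localization r \<in> frob_power S p e I \<longleftrightarrow> r \<in> (F ^^ e) (contraction I)"
proof
  let ?G = "(F ^^ e) (contraction I)"
  have G: "ring_ideal.subspace ?G"
    by (simp add: subspace_frobenius_iter subspace_contraction I)
  have "{x [^]\<^bsub>S\<^esub> (p ^ e) | x. x \<in> I} \<subseteq> extension ?G"
  proof clarify
    fix x assume x: "x \<in> I"
    then have "x \<in> carrier S" using I by (auto simp: ideal_S_iff)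
    then obtain a b where ab: "x = Fraction_Field.Fract a b" "b \<notin> P" by (rule S_cases)
    then have "a ^ (p ^ e) \<in> ?G"
      using x Fract_mem_ideal_iff[OF I ab(2)] by (intro power_mem_frobenius_iter) simp
    moreover have "b ^ n \<notin> P \<and> x ^ n = Fraction_Field.Fract (a ^ n) (b ^ n)" for n
      by (induction n) (simp_all add: P(2) mult_notin_P ab One_fract_def)
    ultimately show "x [^]\<^bsub>S\<^esub> (p ^ e) \<in> extension ?G"
      unfolding S_pow extension_def by blast
  qed
  then have "frob_power S p e I \<subseteq> extension ?G"
    unfolding frob_power_def by (intro ring.genideal_minimal[OF ring_S] ideal_extension[OF G])
  moreover assume "to_localization r \<in> frob_power S p e I"
  ultimately obtain b where b: "b \<notin> P" "r * b \<in> ?G"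
    using mem_contraction_extension[of r ?G] by (auto simp: mem_contraction)
  have "b ^ (p ^ e) = b ^ (p ^ e - 1) * b"
    using power_minus_mult[of "p ^ e" b] p_gt_1 by simp
  then have "b ^ (p ^ e) * r = (r * b) * b ^ (p ^ e - 1)"
    by (simp only: mult_ac)
  then have "b ^ (p ^ e) * r \<in> ?G"
    by (simp only: ideal_mult_right[OF G b(2)])
  then have "r \<in> (F ^^ e) (colon_ideal (contraction I) b)"
    by (simp add: F_iter_colon subspace_contraction I mem_colon_ideal)
  then show "r \<in> ?G" by (simp add: colon_contraction[OF I b(1)])
next
  have gen: "{x [^]\<^bsub>S\<^esub> (p ^ e) | x. x \<in> I} \<subseteq> carrier S"
    using I monoid.nat_pow_closed[OF ring.is_monoid[OF ring_S]] by (auto simp: ideal_S_iff simp del: S_pow)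
  have "ideal (frob_power S p e I) S"
    unfolding frob_power_def by (rule ring.genideal_ideal[OF ring_S gen])
  then have sub: "ring_ideal.subspace (contraction (frob_power S p e I))"
    by (rule subspace_contraction)
  have "a ^ (p ^ e) \<in> contraction (frob_power S p e I)" if "a \<in> contraction I" for a
  proof -
    have "to_localization a [^]\<^bsub>S\<^esub> (p ^ e) \<in> frob_power S p e I"
      using ring.genideal_self[OF ring_S gen] that
      unfolding frob_power_def mem_contraction by blast
    then show ?thesis by (simp add: mem_contraction to_localization_power)
  qed
  then have "ring_ideal.span ((\<lambda>x. x ^ (p ^ e)) ` contraction I) \<subseteq> contraction (frob_power S p e I)"
    using sub by (intro ring_ideal.span_minimal) auto
  moreover assume "r \<in> (F ^^ e) (contraction I)"
  ultimately show "to_localization r \<in> frob_power S p e I"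
    by (auto simp: frobenius_iter_eq_span[OF prime_p CHAR_p subspace_contraction[OF I]] mem_contraction)
qed

lemma ideal_carrier_S: "ideal (carrier S) S"
  by (rule ring.oneideal[OF ring_S])

lemma contraction_proper:
  assumes I: "ideal I S" "I \<noteq> carrier S"
  shows "contraction I \<subseteq> P"
proof (rule ccontr)
  assume "\<not> contraction I \<subseteq> P"
  then obtain a where a: "a \<in> contraction I" "a \<notin> P" by blast
  then have "Fraction_Field.Fract a a \<in> I"
    by (simp add: Fract_mem_ideal_iff I)
  also have "Fraction_Field.Fract a a = 1"
    using nonzero[OF a(2)] by (simp add: One_fract_def eq_fract)
  finally have "1 \<in> I" .
  then have "x \<in> I" if "x \<in> carrier S" for x
    using I(1) that by (metis ideal_S_iff mult.right_neutral)
  then show False using I by (auto simp: ideal_S_iff)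
qed

text \<open>The least ideal exists because Frobenius powers commute with arbitrary intersections.\<close>

lemma frob_root_localization:
  shows "ideal (frob_root S p e (to_localization r)) S"
    and "r \<in> (F ^^ e) (contraction (frob_root S p e (to_localization r)))"
    and "ideal I S \<Longrightarrow> r \<in> (F ^^ e) (contraction I) \<Longrightarrow> frob_root S p e (to_localization r) \<subseteq> I"
proof -
  define A where "A = {I. ideal I S \<and> r \<in> (F ^^ e) (contraction I)}"
  have "contraction (carrier S) = UNIV"
    using to_localization_mem by (auto simp: mem_contraction)
  then have "1 ^ (p ^ e) \<in> (F ^^ e) (contraction (carrier S))"
    by (intro power_mem_frobenius_iter) simp
  then have "1 * r \<in> (F ^^ e) (contraction (carrier S))"
    by (intro ideal_mult_right subspace_frobenius_iter subspace_contraction ideal_carrier_S) simp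
  \<comment> \<open>A must be nonempty: the empty intersection would be the whole fraction field
    instead of an ideal of S.\<close>
  then have ne: "carrier S \<in> A" by (simp add: A_def ideal_carrier_S)
  have ideal: "ideal (\<Inter>A) S"
    unfolding ideal_S_iff
  proof (intro conjI ballI)
    show "\<Inter>A \<subseteq> carrier S" using ne by blast
  qed (auto simp: A_def ideal_S_iff)
  have "(F ^^ e) (contraction (\<Inter>A)) = (\<Inter>C\<in>contraction ` A. (F ^^ e) C)"
    unfolding contraction_Inter
    by (rule F_iter_Inter) (auto simp: A_def subspace_contraction)
  then have mem: "r \<in> (F ^^ e) (contraction (\<Inter>A))"
    by (auto simp: A_def)
  have "frob_root S p e (to_localization r) = \<Inter>A"
    unfolding frob_root_def
  proof (rule Least_equality)
    show "ideal (\<Inter>A) S \<and> to_localization r \<in> frob_power S p e (\<Inter>A)"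
      using ideal mem by (simp add: mem_frob_power_iff)
    show "\<Inter>A \<subseteq> I" if "ideal I S \<and> to_localization r \<in> frob_power S p e I" for I
      using that by (auto simp: A_def mem_frob_power_iff)
  qed
  then show "ideal (frob_root S p e (to_localization r)) S"
    "r \<in> (F ^^ e) (contraction (frob_root S p e (to_localization r)))"
    "ideal I S \<Longrightarrow> r \<in> (F ^^ e) (contraction I) \<Longrightarrow> frob_root S p e (to_localization r) \<subseteq> I"
    using ideal mem by (auto simp: A_def)
qed

lemma contraction_extension_P: "contraction (extension P) = P"
proof -
  have "a \<in> contraction (extension P) \<longleftrightarrow> a \<in> P" for a
    unfolding mem_contraction_extension using P(2,3) ideal_mult_right[OF P(1), of a] by blast
  then show ?thesis by blast
qed

text \<open>S is local with maximal ideal \<open>extension P\<close>, so the least ideal is proper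
  exactly when \<open>extension P\<close> is itself a candidate for it.\<close>

lemma one_mem_frob_root_iff:
  "1 \<in> frob_root S p e (to_localization r) \<longleftrightarrow> r \<notin> (F ^^ e) P"
proof
  assume one: "1 \<in> frob_root S p e (to_localization r)"
  show "r \<notin> (F ^^ e) P"
  proof
    assume "r \<in> (F ^^ e) P"
    then have "frob_root S p e (to_localization r) \<subseteq> extension P"
      by (intro frob_root_localization(3) ideal_extension P) (simp add: contraction_extension_P)
    then have "1 \<in> contraction (extension P)"
      using one by (auto simp: mem_contraction to_localization_hom)
    then show False using P(2) by (simp add: contraction_extension_P)
  qed
next
  assume r: "r \<notin> (F ^^ e) P"
  let ?I = "frob_root S p e (to_localization r)"
  have "\<not> contraction ?I \<subseteq> P"
    using frobenius_iter_mono[of "contraction ?I" P e p] frob_root_localization(2)[of r e] r by blast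
  then have "?I = carrier S" using contraction_proper frob_root_localization(1) by blast
  then show "1 \<in> ?I" using to_localization_mem[of 1] by (simp add: to_localization_hom)
qed

text \<open>The union is S exactly when 1 lies in one of its members, and that member is then
  already S.\<close>

lemma test_ideal_eq_carrier_iff:
  "test_ideal S p (to_localization g) t = carrier S \<longleftrightarrow>
    (\<exists>e\<ge>1. g ^ nat \<lceil>real p ^ e * t\<rceil> \<notin> (F ^^ e) P)"
proof -
  let ?I = "\<lambda>e. frob_root S p e (to_localization (g ^ nat \<lceil>real p ^ e * t\<rceil>))"
  have test: "test_ideal S p (to_localization g) t = (\<Union>e\<in>{1..}. ?I e)"
    by (simp add: test_ideal_def to_localization_power)
  have "(\<Union>e\<in>{1..}. ?I e) = carrier S \<longleftrightarrow> (\<exists>e\<ge>1. 1 \<in> ?I e)"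
  proof
    assume "(\<Union>e\<in>{1..}. ?I e) = carrier S"
    then have "1 \<in> (\<Union>e\<in>{1..}. ?I e)" using to_localization_mem[of 1] by (simp add: to_localization_hom)
    then show "\<exists>e\<ge>1. 1 \<in> ?I e" by auto
  next
    assume "\<exists>e\<ge>1. 1 \<in> ?I e"
    then obtain e where e: "e \<ge> 1" "1 \<in> ?I e" by blast
    have "x \<in> ?I e" if "x \<in> carrier S" for x
      using frob_root_localization(1)[of e "g ^ nat \<lceil>real p ^ e * t\<rceil>"] e(2) that
      by (metis ideal_S_iff mult.right_neutral)
    moreover have "?I e' \<subseteq> carrier S" for e'
      using frob_root_localization(1)[of e' "g ^ nat \<lceil>real p ^ e' * t\<rceil>"] by (simp only: ideal_S_iff)
    ultimately show "(\<Union>e\<in>{1..}. ?I e) = carrier S" using e(1) by (intro subset_antisym UN_least subsetI UN_I) auto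
  qed
  then show ?thesis by (simp add: test one_mem_frob_root_iff)
qed

end


section \<open>The origin as a prime ideal, the constant N, and the comparison of thresholds\<close>

lemma mem_irrelevant_ideal_iff:
  fixes f :: "('n::finite, 'k::comm_ring_1) mpoly"
  shows "f \<in> irrelevant_ideal \<longleftrightarrow> lookup f 0 = 0"
proof -
  have "exp_degree a = 0 \<longleftrightarrow> a = 0" for a :: "'n \<Rightarrow>\<^sub>0 nat"
    by (auto simp: exp_degree_def intro: poly_mapping_eqI)
  then show ?thesis by (simp add: irrelevant_ideal_eq mem_order_ideal_iff)
qed

text \<open>Replacing both factors by their constant terms changes the product by an element of m.
  Multiplicativity of evaluation at the origin is what makes m prime.\<close>

lemma lookup_mult_zero:
  fixes f g :: "('n::finite, 'k::comm_ring_1) mpoly"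
  shows "lookup (f * g) 0 = lookup f 0 * lookup g 0"
proof -
  define f0 g0 :: "('n, 'k) mpoly" where "f0 = single 0 (lookup f 0)" and "g0 = single 0 (lookup g 0)"
  have sub: "ring_ideal.subspace (irrelevant_ideal :: ('n, 'k) mpoly set)"
    by (simp add: irrelevant_ideal_eq)
  have "(f - f0) * g \<in> irrelevant_ideal" "f0 * (g - g0) \<in> irrelevant_ideal"
    by (intro ideal_mult_right[OF sub] ring_ideal.subspace_scale[OF sub];
        simp add: mem_irrelevant_ideal_iff lookup_minus f0_def g0_def)+
  then have "(f - f0) * g + f0 * (g - g0) \<in> irrelevant_ideal"
    by (rule ring_ideal.subspace_add[OF sub])
  also have "(f - f0) * g + f0 * (g - g0) = f * g - f0 * g0"
    by (simp add: algebra_simps)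
  finally show ?thesis
    by (simp add: mem_irrelevant_ideal_iff lookup_minus f0_def g0_def mult_single)
qed

text \<open>From l + 1 <= 2^l <= p^l <= p^(2l-1) one gets p (l+1) <= p^(2l); multiplying by n covers
  both p l and n (p-1), and the remaining p stands on the right. The third inequality needs l >
  0.\<close>

lemma degree_bound:
  fixes p l n :: nat
  assumes "p > 1" "l > 0" "n > 0"
  shows "p * Suc l + n * (p - 1) < p ^ (2 * l) * n + p"
proof -
  have "Suc l \<le> 2 ^ l" by (simp add: Suc_leI less_exp)
  also have "\<dots> \<le> p ^ l" using assms(1) by (intro power_mono) auto
  also have "\<dots> \<le> p ^ (2 * l - 1)" using assms by (intro power_increasing) auto
  finally have "p * Suc l \<le> p * p ^ (2 * l - 1)" by (rule mult_le_mono2)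
  also have "\<dots> = p ^ (2 * l)" using assms(2) by (simp flip: power_Suc)
  finally have "p * Suc l \<le> p ^ (2 * l)" .
  then have "n * p + n * (p * l) \<le> p ^ (2 * l) * n"
    using mult_le_mono2[of "p * Suc l" "p ^ (2 * l)" n] by (simp add: distrib_left mult.commute)
  moreover have "p * l \<le> n * (p * l)" "n * (p - 1) < n * p" "p * Suc l = p + p * l"
    using assms by auto
  ultimately show ?thesis by linarith
qed


theorem theorem4p3:
  fixes p l N :: nat
    and f :: "('n::{finite, linorder}, 'k::field) mpoly"
  assumes "Factorial_Ring.prime p" and "CHAR('k) = p"
    and "F_finite_field (ring_on (UNIV :: 'k set)) p"
    and "ideal_radical mpoly_ring (Jac f) = irrelevant_ideal"
    and "l = the_enat (module_length mpoly_ring (quotient_module mpoly_ring (Jac f)))"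
    and "N = p ^ (2 * l) * CARD('n)"
  shows "\<forall>h \<in> irrelevant_ideal [^]\<^bsub>ideals_set mpoly_ring\<^esub> N.
           fpt (localization irrelevant_ideal) p (to_localization f) =
           fpt (localization irrelevant_ideal) p (to_localization (f + h))"
proof
  fix h :: "('n, 'k) mpoly"
  assume "h \<in> irrelevant_ideal [^]\<^bsub>ideals_set mpoly_ring\<^esub> N"
  then have hN: "h \<in> order_ideal N" using irrelevant_ideal_power_subset by blast
  note p = \<open>Factorial_Ring.prime p\<close> \<open>CHAR('k) = p\<close>
  have p1: "p > 1" using p(1) prime_gt_1_nat by blast
  interpret cartier_ring p "mpoly_cartier_maps p :: (('n, 'k) mpoly \<Rightarrow> _) set"
    by (rule cartier_ring_mpoly[OF p])
  interpret L: localized_cartier_ring p "mpoly_cartier_maps p :: (('n, 'k) mpoly \<Rightarrow> _) set" irrelevant_ideal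
  proof
    show "ring_ideal.subspace (irrelevant_ideal :: ('n, 'k) mpoly set)"
      by (simp add: irrelevant_ideal_eq)
    show "(1 :: ('n, 'k) mpoly) \<notin> irrelevant_ideal"
      by (simp add: mem_irrelevant_ideal_iff)
    show "a \<in> irrelevant_ideal \<or> b \<in> irrelevant_ideal" if "a * b \<in> irrelevant_ideal" for a b :: "('n, 'k) mpoly"
      using that by (simp add: mem_irrelevant_ideal_iff lookup_mult_zero)
  qed
  have primary: "primary_to_origin (Jac f)"
    by (rule Jac_primary_to_origin) fact
  have l: "order_ideal l \<subseteq> Jac f"
    by (rule order_ideal_length_subset[OF primary]) fact
  have J1: "Jac f \<subseteq> order_ideal 1"
    by (rule Jac_subset_order_ideal) fact
  \<comment> \<open>For l = 0 the degree bound fails; this case would make \<open>Jac f\<close> the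
    unit ideal, whereas its radical is m.\<close>
  have "l \<noteq> 0"
  proof
    assume "l = 0"
    then have "1 \<in> Jac f" using l by auto
    then show False using J1 L.P(2) by (auto simp: irrelevant_ideal_eq)
  qed
  then have "N + p > p * Suc l + CARD('n) * (p - 1)"
    using degree_bound[OF p1, of l "CARD('n)"] \<open>N = _\<close> by simp
  then have h: "h \<in> F (order_ideal (Suc l))"
    using order_ideal_subset_frobenius_ideal[of p "Suc l" N] hN p1 by auto
  have close: "f + h - f \<in> F K" if "Jac f \<subseteq> K" for K
  proof -
    have "order_ideal (Suc l) \<subseteq> K" using l that order_ideal_antimono[of l "Suc l"] by auto
    from frobenius_ideal_mono[OF this, of p] show ?thesis using h by auto
  qed
  have f1: "f \<in> order_ideal 1"
    using J1 Jac_subset_iff[of "Jac f" f] by auto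
  \<comment> \<open>Order at least 1 puts h into m, so that f + h also vanishes at the
    origin.\<close>
  have N1: "N \<ge> 1" using p1 \<open>N = _\<close> by simp
  then have fh1: "f + h \<in> order_ideal 1"
    using hN f1 order_ideal_antimono[OF N1] by (auto intro: ring_ideal.subspace_add)
  \<comment> \<open>With agreement for all a and e, the exponents t with trivial test ideal are the
    same for f and f + h, and the suprema are taken over equal sets.\<close>
  have "f ^ a \<in> (F ^^ e) (order_ideal 1) \<longleftrightarrow> (f + h) ^ a \<in> (F ^^ e) (order_ideal 1)" for a e
  proof (cases "a < p ^ e")
    case True
    show ?thesis
    proof (rule frobenius_membership_perturbation[where P = primary_to_origin and J = "Jac f"])
      show "primary_to_origin (order_ideal 1 :: ('n, 'k) mpoly set)"
        by (auto simp: primary_to_origin_def)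
    next
      fix K :: "('n, 'k) mpoly set" assume K: "primary_to_origin K"
      show sub: "ring_ideal.subspace K" using K by (simp add: primary_to_origin_def)
      show "primary_to_origin (F K)" using primary_to_origin_frobenius[OF _ K] p1 by simp
      show "Jac f \<subseteq> K" if "\<And>j. j \<in> Jac f \<Longrightarrow> f ^ (p - 1) * j \<in> F K"
        by (rule jacobian_descent[OF p sub that])
      show "Jac f \<subseteq> K" if "\<And>j. j \<in> Jac f \<Longrightarrow> (f + h) ^ (p - 1) * j \<in> F K"
        by (rule jacobian_descent_perturbed[OF p l h K that])
      show "f + h - f \<in> F K" if "Jac f \<subseteq> K" by (rule close[OF that])
      show "primary_to_origin L" if "K \<subseteq> L" "ring_ideal.subspace L" for L
        using K that by (auto simp: primary_to_origin_def)
    qed (fact True)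
  next
    case False
    \<comment> \<open>For a >= p^e both memberships hold: an element of m raised to p^e is already a
      generator of m^[p^e].\<close>
    have "g ^ a \<in> (F ^^ e) (order_ideal 1)" if "g \<in> order_ideal 1" for g :: "('n, 'k) mpoly"
    proof -
      have "g ^ (p ^ e) * g ^ (a - p ^ e) \<in> (F ^^ e) (order_ideal 1)"
        by (intro ideal_mult_right subspace_frobenius_iter power_mem_frobenius_iter that) simp
      then show ?thesis using False by (simp flip: power_add)
    qed
    then show ?thesis using f1 fh1 by blast
  qed
  then show "fpt (localization irrelevant_ideal) p (to_localization f) =
      fpt (localization irrelevant_ideal) p (to_localization (f + h))"
    unfolding fpt_def L.test_ideal_eq_carrier_iff by (simp only: irrelevant_ideal_eq)
qed

end
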